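(* Fix an integer $d\ge2$. Let $T_d=d\mathbb Z$, $\Gamma=\mathbb Z$, with ternary operation $x\,n\,y\,m\,z=nmxyz$. Let $x=d$ be the additive generator of $T_d$. Then $$\mathcal O(T_d,\mathbb Z)=\mathbb Zt,\qquad t=x\otimes x,\qquad t^2=d^2t.$$ The intrinsic regular representation is injective and sends $t$ to $d^2\operatorname{id}_{T_d}$. Hence $\mathfrak D(T_d,\mathbb Z)=0$. For $$\mathcal A_d=\mathcal A(T_d,\mathbb Z)=\mathbb Z[t]/(t^2-d^2t),\qquad\mathcal R_d=\mathcal R_{T_d}\cong\mathbb Z\quad\text{with }t\mapsto d^2,$$ the unital defect $K=\mathfrak K(T_d,\mathbb Z)$ is generated by $\kappa=t-d^2$. It satisfies $$\kappa^2=-d^2\kappa,\qquad K^n=d^{2(n-1)}K.$$ Consequently, $\mathcal C_n(T_d,\mathbb Z)=K^n/K^{n+1}\cong\mathbb Z/d^2\mathbb Z$ for every $n\ge1$.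
   Context: For an additive ternary $\Gamma$-ring $T$ (abelian groups $T,\Gamma$ with an operation $x\alpha y\beta z\in T$ additive in all five variables and satisfying $(x\alpha y\beta z)\gamma u\delta v=x\alpha(y\beta z\gamma u)\delta v=x\alpha y\beta(z\gamma u\delta v)$): $F(T,\Gamma)=T\otimes_{\mathbb Z}\Gamma\otimes_{\mathbb Z}T\otimes_{\mathbb Z}\Gamma$ carries the associative multiplication $(a\otimes\alpha\otimes b\otimes\beta)(c\otimes\gamma\otimes d'\otimes\delta)=(a\alpha b\beta c)\otimes\gamma\otimes d'\otimes\delta$; $\mathcal O(T,\Gamma)$ is its quotient by the two-sided ideal generated by all $(a\alpha b\beta c)\otimes\gamma\otimes d'\otimes\delta-a\otimes\alpha\otimes(b\beta c\gamma d')\otimes\delta$; $[a,\alpha,b,\beta]$ is the class of a pure tensor; $\mathcal A(T,\Gamma)=\mathbb Z\oplus\mathcal O(T,\Gamma)$ with $(n,r)(m,s)=(nm,ns+mr+rs)$. The (intrinsic) regular representation is $\rho_T:\mathcal O(T,\Gamma)\to\operatorname{End}_{\mathbb Z}(T)$, $\rho_T([a,\alpha,b,\beta])(x)=a\alpha b\beta x$, and $\widehat\rho_T(n,u)=n\operatorname{id}_T+\rho_T(u)$ on $\mathcal A(T,\Gamma)$. Then $\mathfrak D(T,\Gamma)=\ker\rho_T$, $\mathfrak K(T,\Gamma)=\ker\widehat\rho_T$ (unital regular defect), $\mathcal R_T=\operatorname{im}\widehat\rho_T$. When $\Gamma=\mathbb Z$, $F(T,\mathbb Z)$ is identified with $T\otimes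 T$, and $x\otimes x$ in the statement denotes its class in $\mathcal O(T_d,\mathbb Z)$. *)

theory Defs
  imports
    "HOL-Algebra.Free_Abelian_Groups"
    "HOL-Algebra.Generated_Groups"
    "HOL-Algebra.Ideal_Product"
    "HOL-Algebra.IntRing"
    "HOL-Algebra.UnivPoly"
begin

text \<open>The additive groups T and \<Gamma> are HOL-Algebra \<open>comm_group\<close>s, so their addition is the
  record operation \<open>\<otimes>\<close>; \<open>tern x \<alpha> y \<beta> z\<close> is \<open>x\<alpha>y\<beta>z\<close>.\<close>

locale ternary_gamma_ring = T: comm_group T + G: comm_group \<Gamma>
  for T :: "('a, 'm) monoid_scheme" and \<Gamma> :: "('g, 'n) monoid_scheme"
    and tern :: "'a \<Rightarrow> 'g \<Rightarrow> 'a \<Rightarrow> 'g \<Rightarrow> 'a \<Rightarrow> 'a" +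
  assumes tern_closed:
    "\<lbrakk>x \<in> carrier T; \<alpha> \<in> carrier \<Gamma>; y \<in> carrier T; \<beta> \<in> carrier \<Gamma>; z \<in> carrier T\<rbrakk>
      \<Longrightarrow> tern x \<alpha> y \<beta> z \<in> carrier T"
  and tern_add1:
    "\<lbrakk>x \<in> carrier T; x' \<in> carrier T; \<alpha> \<in> carrier \<Gamma>; y \<in> carrier T; \<beta> \<in> carrier \<Gamma>; z \<in> carrier T\<rbrakk>
      \<Longrightarrow> tern (x \<otimes>\<^bsub>T\<^esub> x') \<alpha> y \<beta> z = tern x \<alpha> y \<beta> z \<otimes>\<^bsub>T\<^esub> tern x' \<alpha> y \<beta> z"
  and tern_add2:
    "\<lbrakk>x \<in> carrier T; \<alpha> \<in> carrier \<Gamma>; \<alpha>' \<in> carrier \<Gamma>; y \<in> carrier T; \<beta> \<in> carrier \<Gamma>; z \<in> carrier T\<rbrakk>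
      \<Longrightarrow> tern x (\<alpha> \<otimes>\<^bsub>\<Gamma>\<^esub> \<alpha>') y \<beta> z = tern x \<alpha> y \<beta> z \<otimes>\<^bsub>T\<^esub> tern x \<alpha>' y \<beta> z"
  and tern_add3:
    "\<lbrakk>x \<in> carrier T; \<alpha> \<in> carrier \<Gamma>; y \<in> carrier T; y' \<in> carrier T; \<beta> \<in> carrier \<Gamma>; z \<in> carrier T\<rbrakk>
      \<Longrightarrow> tern x \<alpha> (y \<otimes>\<^bsub>T\<^esub> y') \<beta> z = tern x \<alpha> y \<beta> z \<otimes>\<^bsub>T\<^esub> tern x \<alpha> y' \<beta> z"
  and tern_add4:
    "\<lbrakk>x \<in> carrier T; \<alpha> \<in> carrier \<Gamma>; y \<in> carrier T; \<beta> \<in> carrier \<Gamma>; \<beta>' \<in> carrier \<Gamma>; z \<in> carrier T\<rbrakk>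
      \<Longrightarrow> tern x \<alpha> y (\<beta> \<otimes>\<^bsub>\<Gamma>\<^esub> \<beta>') z = tern x \<alpha> y \<beta> z \<otimes>\<^bsub>T\<^esub> tern x \<alpha> y \<beta>' z"
  and tern_add5:
    "\<lbrakk>x \<in> carrier T; \<alpha> \<in> carrier \<Gamma>; y \<in> carrier T; \<beta> \<in> carrier \<Gamma>; z \<in> carrier T; z' \<in> carrier T\<rbrakk>
      \<Longrightarrow> tern x \<alpha> y \<beta> (z \<otimes>\<^bsub>T\<^esub> z') = tern x \<alpha> y \<beta> z \<otimes>\<^bsub>T\<^esub> tern x \<alpha> y \<beta> z'"
  and tern_assoc1:
    "\<lbrakk>x \<in> carrier T; \<alpha> \<in> carrier \<Gamma>; y \<in> carrier T; \<beta> \<in> carrier \<Gamma>; z \<in> carrier T;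
      \<gamma> \<in> carrier \<Gamma>; u \<in> carrier T; \<delta> \<in> carrier \<Gamma>; v \<in> carrier T\<rbrakk>
      \<Longrightarrow> tern (tern x \<alpha> y \<beta> z) \<gamma> u \<delta> v = tern x \<alpha> (tern y \<beta> z \<gamma> u) \<delta> v"
  and tern_assoc2:
    "\<lbrakk>x \<in> carrier T; \<alpha> \<in> carrier \<Gamma>; y \<in> carrier T; \<beta> \<in> carrier \<Gamma>; z \<in> carrier T;
      \<gamma> \<in> carrier \<Gamma>; u \<in> carrier T; \<delta> \<in> carrier \<Gamma>; v \<in> carrier T\<rbrakk>
      \<Longrightarrow> tern x \<alpha> (tern y \<beta> z \<gamma> u) \<delta> v = tern x \<alpha> y \<beta> (tern z \<gamma> u \<delta> v)"


section \<open>The tensor ring F and its quotient O\<close>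

text \<open>F and O are in general not unital.  They are nevertheless represented by \<open>ring\<close> records,
  in order to use the quotient construction \<open>Quot\<close>, which does not refer to the unit; their field
  \<open>one\<close> carries no meaning.\<close>

fun quad_mult :: "('a \<Rightarrow> 'g \<Rightarrow> 'a \<Rightarrow> 'g \<Rightarrow> 'a \<Rightarrow> 'a)
    \<Rightarrow> 'a \<times> 'g \<times> 'a \<times> 'g \<Rightarrow> 'a \<times> 'g \<times> 'a \<times> 'g \<Rightarrow> 'a \<times> 'g \<times> 'a \<times> 'g" where
  "quad_mult tern (a, \<alpha>, b, \<beta>) (c, \<gamma>, d, \<delta>) = (tern a \<alpha> b \<beta> c, \<gamma>, d, \<delta>)"

text \<open>The free abelian group on \<open>T \<times> \<Gamma> \<times> T \<times> \<Gamma>\<close> with the biadditive extension of \<open>quad_mult\<close>.\<close>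

definition quad_rng :: "('a, 'm) monoid_scheme \<Rightarrow> ('g, 'n) monoid_scheme
    \<Rightarrow> ('a \<Rightarrow> 'g \<Rightarrow> 'a \<Rightarrow> 'g \<Rightarrow> 'a \<Rightarrow> 'a) \<Rightarrow> ('a \<times> 'g \<times> 'a \<times> 'g \<Rightarrow>\<^sub>0 int) ring" where
  "quad_rng T \<Gamma> tern =
    \<lparr>carrier = carrier (free_Abelian_group (carrier T \<times> carrier \<Gamma> \<times> carrier T \<times> carrier \<Gamma>)),
     monoid.mult = (\<lambda>p q. frag_extend (\<lambda>u. frag_extend (\<lambda>v. frag_of (quad_mult tern u v)) q) p),
     one = 0, ring.zero = 0, ring.add = (+)\<rparr>"

definition tensor_rels :: "('a, 'm) monoid_scheme \<Rightarrow> ('g, 'n) monoid_scheme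
    \<Rightarrow> ('a \<times> 'g \<times> 'a \<times> 'g \<Rightarrow>\<^sub>0 int) set" where
  "tensor_rels T \<Gamma> =
    {frag_of (a \<otimes>\<^bsub>T\<^esub> a', \<alpha>, b, \<beta>) - frag_of (a, \<alpha>, b, \<beta>) - frag_of (a', \<alpha>, b, \<beta>) | a a' \<alpha> b \<beta>.
       a \<in> carrier T \<and> a' \<in> carrier T \<and> \<alpha> \<in> carrier \<Gamma> \<and> b \<in> carrier T \<and> \<beta> \<in> carrier \<Gamma>} \<union>
    {frag_of (a, \<alpha> \<otimes>\<^bsub>\<Gamma>\<^esub> \<alpha>', b, \<beta>) - frag_of (a, \<alpha>, b, \<beta>) - frag_of (a, \<alpha>', b, \<beta>) | a \<alpha> \<alpha>' b \<beta>.
       a \<in> carrier T \<and> \<alpha> \<in> carrier \<Gamma> \<and> \<alpha>' \<in> carrier \<Gamma> \<and> b \<in> carrier T \<and> \<beta> \<in> carrier \<Gamma>} \<union>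
    {frag_of (a, \<alpha>, b \<otimes>\<^bsub>T\<^esub> b', \<beta>) - frag_of (a, \<alpha>, b, \<beta>) - frag_of (a, \<alpha>, b', \<beta>) | a \<alpha> b b' \<beta>.
       a \<in> carrier T \<and> \<alpha> \<in> carrier \<Gamma> \<and> b \<in> carrier T \<and> b' \<in> carrier T \<and> \<beta> \<in> carrier \<Gamma>} \<union>
    {frag_of (a, \<alpha>, b, \<beta> \<otimes>\<^bsub>\<Gamma>\<^esub> \<beta>') - frag_of (a, \<alpha>, b, \<beta>) - frag_of (a, \<alpha>, b, \<beta>') | a \<alpha> b \<beta> \<beta>'.
       a \<in> carrier T \<and> \<alpha> \<in> carrier \<Gamma> \<and> b \<in> carrier T \<and> \<beta> \<in> carrier \<Gamma> \<and> \<beta>' \<in> carrier \<Gamma>}"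

definition tensor_null :: "('a, 'm) monoid_scheme \<Rightarrow> ('g, 'n) monoid_scheme
    \<Rightarrow> ('a \<Rightarrow> 'g \<Rightarrow> 'a \<Rightarrow> 'g \<Rightarrow> 'a \<Rightarrow> 'a) \<Rightarrow> ('a \<times> 'g \<times> 'a \<times> 'g \<Rightarrow>\<^sub>0 int) set" where
  "tensor_null T \<Gamma> tern = generate (add_monoid (quad_rng T \<Gamma> tern)) (tensor_rels T \<Gamma>)"

text \<open>The four-fold tensor product \<open>F(T,\<Gamma>) = T \<otimes> \<Gamma> \<otimes> T \<otimes> \<Gamma>\<close> over the integers.\<close>

definition tensor_rng :: "('a, 'm) monoid_scheme \<Rightarrow> ('g, 'n) monoid_scheme
    \<Rightarrow> ('a \<Rightarrow> 'g \<Rightarrow> 'a \<Rightarrow> 'g \<Rightarrow> 'a \<Rightarrow> 'a) \<Rightarrow> (('a \<times> 'g \<times> 'a \<times> 'g \<Rightarrow>\<^sub>0 int) set) ring" where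
  "tensor_rng T \<Gamma> tern = quad_rng T \<Gamma> tern Quot tensor_null T \<Gamma> tern"

definition pure_tensor :: "('a, 'm) monoid_scheme \<Rightarrow> ('g, 'n) monoid_scheme
    \<Rightarrow> ('a \<Rightarrow> 'g \<Rightarrow> 'a \<Rightarrow> 'g \<Rightarrow> 'a \<Rightarrow> 'a) \<Rightarrow> 'a \<Rightarrow> 'g \<Rightarrow> 'a \<Rightarrow> 'g
    \<Rightarrow> ('a \<times> 'g \<times> 'a \<times> 'g \<Rightarrow>\<^sub>0 int) set" where
  "pure_tensor T \<Gamma> tern a \<alpha> b \<beta> =
    tensor_null T \<Gamma> tern +>\<^bsub>quad_rng T \<Gamma> tern\<^esub> frag_of (a, \<alpha>, b, \<beta>)"

text \<open>The library's \<open>ideal\<close> and \<open>genideal\<close> require a unital ring.\<close>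

definition rng_ideal :: "'r set \<Rightarrow> ('r, 'm) ring_scheme \<Rightarrow> bool" where
  "rng_ideal I R \<longleftrightarrow> additive_subgroup I R \<and>
    (\<forall>a\<in>I. \<forall>x\<in>carrier R. x \<otimes>\<^bsub>R\<^esub> a \<in> I \<and> a \<otimes>\<^bsub>R\<^esub> x \<in> I)"

definition rng_genideal :: "('r, 'm) ring_scheme \<Rightarrow> 'r set \<Rightarrow> 'r set" where
  "rng_genideal R S = \<Inter>{I. rng_ideal I R \<and> S \<subseteq> I}"

definition op_null :: "('a, 'm) monoid_scheme \<Rightarrow> ('g, 'n) monoid_scheme
    \<Rightarrow> ('a \<Rightarrow> 'g \<Rightarrow> 'a \<Rightarrow> 'g \<Rightarrow> 'a \<Rightarrow> 'a) \<Rightarrow> ('a \<times> 'g \<times> 'a \<times> 'g \<Rightarrow>\<^sub>0 int) set set" where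
  "op_null T \<Gamma> tern = rng_genideal (tensor_rng T \<Gamma> tern)
    {pure_tensor T \<Gamma> tern (tern a \<alpha> b \<beta> c) \<gamma> d \<delta>
       \<ominus>\<^bsub>tensor_rng T \<Gamma> tern\<^esub> pure_tensor T \<Gamma> tern a \<alpha> (tern b \<beta> c \<gamma> d) \<delta> | a \<alpha> b \<beta> c \<gamma> d \<delta>.
       a \<in> carrier T \<and> \<alpha> \<in> carrier \<Gamma> \<and> b \<in> carrier T \<and> \<beta> \<in> carrier \<Gamma> \<and>
       c \<in> carrier T \<and> \<gamma> \<in> carrier \<Gamma> \<and> d \<in> carrier T \<and> \<delta> \<in> carrier \<Gamma>}"

definition op_rng :: "('a, 'm) monoid_scheme \<Rightarrow> ('g, 'n) monoid_scheme
    \<Rightarrow> ('a \<Rightarrow> 'g \<Rightarrow> 'a \<Rightarrow> 'g \<Rightarrow> 'a \<Rightarrow> 'a) \<Rightarrow> (('a \<times> 'g \<times> 'a \<times> 'g \<Rightarrow>\<^sub>0 int) set set) ring" where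
  "op_rng T \<Gamma> tern = tensor_rng T \<Gamma> tern Quot op_null T \<Gamma> tern"

text \<open>\<open>bracket T \<Gamma> tern a \<alpha> b \<beta>\<close> is \<open>[a,\<alpha>,b,\<beta>]\<close>.\<close>

definition bracket :: "('a, 'm) monoid_scheme \<Rightarrow> ('g, 'n) monoid_scheme
    \<Rightarrow> ('a \<Rightarrow> 'g \<Rightarrow> 'a \<Rightarrow> 'g \<Rightarrow> 'a \<Rightarrow> 'a) \<Rightarrow> 'a \<Rightarrow> 'g \<Rightarrow> 'a \<Rightarrow> 'g
    \<Rightarrow> ('a \<times> 'g \<times> 'a \<times> 'g \<Rightarrow>\<^sub>0 int) set set" where
  "bracket T \<Gamma> tern a \<alpha> b \<beta> =
    op_null T \<Gamma> tern +>\<^bsub>tensor_rng T \<Gamma> tern\<^esub> pure_tensor T \<Gamma> tern a \<alpha> b \<beta>"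

text \<open>The unitalization \<open>\<A>(T,\<Gamma>) = \<int> \<oplus> \<O>(T,\<Gamma>)\<close>.\<close>

definition unital_op_ring :: "('a, 'm) monoid_scheme \<Rightarrow> ('g, 'n) monoid_scheme
    \<Rightarrow> ('a \<Rightarrow> 'g \<Rightarrow> 'a \<Rightarrow> 'g \<Rightarrow> 'a \<Rightarrow> 'a)
    \<Rightarrow> (int \<times> ('a \<times> 'g \<times> 'a \<times> 'g \<Rightarrow>\<^sub>0 int) set set) ring" where
  "unital_op_ring T \<Gamma> tern = (let R = op_rng T \<Gamma> tern in
    \<lparr>carrier = UNIV \<times> carrier R,
     monoid.mult = (\<lambda>(n, r) (m, s). (n * m, (add_pow R n s \<oplus>\<^bsub>R\<^esub> add_pow R m r) \<oplus>\<^bsub>R\<^esub> (r \<otimes>\<^bsub>R\<^esub> s))),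
     one = (1, \<zero>\<^bsub>R\<^esub>),
     ring.zero = (0, \<zero>\<^bsub>R\<^esub>),
     ring.add = (\<lambda>(n, r) (m, s). (n + m, r \<oplus>\<^bsub>R\<^esub> s))\<rparr>)"


section \<open>Regular representations and defects\<close>

definition End_ring :: "('a, 'm) monoid_scheme \<Rightarrow> ('a \<Rightarrow> 'a) ring" where
  "End_ring T =
    \<lparr>carrier = hom T T \<inter> extensional (carrier T),
     monoid.mult = (\<lambda>f g. compose (carrier T) f g),
     one = (\<lambda>x\<in>carrier T. x),
     ring.zero = (\<lambda>x\<in>carrier T. \<one>\<^bsub>T\<^esub>),
     ring.add = (\<lambda>f g. \<lambda>x\<in>carrier T. f x \<otimes>\<^bsub>T\<^esub> g x)\<rparr>"

text \<open>The additive extension of \<open>(a,\<alpha>,b,\<beta>) \<mapsto> (x \<mapsto> a\<alpha>b\<beta>x)\<close> to formal integer combinations.  An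
  element of \<open>op_rng\<close> is a set of cosets, and its union consists of all the formal
  combinations that represent it; \<open>reg_rep\<close> is the map induced on classes.\<close>

definition quad_rep :: "('a, 'm) monoid_scheme \<Rightarrow> ('a \<Rightarrow> 'g \<Rightarrow> 'a \<Rightarrow> 'g \<Rightarrow> 'a \<Rightarrow> 'a)
    \<Rightarrow> ('a \<times> 'g \<times> 'a \<times> 'g \<Rightarrow>\<^sub>0 int) \<Rightarrow> ('a \<Rightarrow> 'a)" where
  "quad_rep T tern p = (\<lambda>x\<in>carrier T.
    finprod T (\<lambda>(a, \<alpha>, b, \<beta>). tern a \<alpha> b \<beta> x [^]\<^bsub>T\<^esub> Poly_Mapping.lookup p (a, \<alpha>, b, \<beta>))
      (Poly_Mapping.keys p))"

definition reg_rep :: "('a, 'm) monoid_scheme \<Rightarrow> ('a \<Rightarrow> 'g \<Rightarrow> 'a \<Rightarrow> 'g \<Rightarrow> 'a \<Rightarrow> 'a)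
    \<Rightarrow> ('a \<times> 'g \<times> 'a \<times> 'g \<Rightarrow>\<^sub>0 int) set set \<Rightarrow> ('a \<Rightarrow> 'a)" where
  "reg_rep T tern X = the_elem (quad_rep T tern ` (\<Union>X))"

definition unital_reg_rep :: "('a, 'm) monoid_scheme \<Rightarrow> ('a \<Rightarrow> 'g \<Rightarrow> 'a \<Rightarrow> 'g \<Rightarrow> 'a \<Rightarrow> 'a)
    \<Rightarrow> int \<times> ('a \<times> 'g \<times> 'a \<times> 'g \<Rightarrow>\<^sub>0 int) set set \<Rightarrow> ('a \<Rightarrow> 'a)" where
  "unital_reg_rep T tern = (\<lambda>(n, u).
    add_pow (End_ring T) n \<one>\<^bsub>End_ring T\<^esub> \<oplus>\<^bsub>End_ring T\<^esub> reg_rep T tern u)"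

definition regular_defect :: "('a, 'm) monoid_scheme \<Rightarrow> ('g, 'n) monoid_scheme
    \<Rightarrow> ('a \<Rightarrow> 'g \<Rightarrow> 'a \<Rightarrow> 'g \<Rightarrow> 'a \<Rightarrow> 'a) \<Rightarrow> ('a \<times> 'g \<times> 'a \<times> 'g \<Rightarrow>\<^sub>0 int) set set set" where
  "regular_defect T \<Gamma> tern = a_kernel (op_rng T \<Gamma> tern) (End_ring T) (reg_rep T tern)"

definition unital_defect :: "('a, 'm) monoid_scheme \<Rightarrow> ('g, 'n) monoid_scheme
    \<Rightarrow> ('a \<Rightarrow> 'g \<Rightarrow> 'a \<Rightarrow> 'g \<Rightarrow> 'a \<Rightarrow> 'a)
    \<Rightarrow> (int \<times> ('a \<times> 'g \<times> 'a \<times> 'g \<Rightarrow>\<^sub>0 int) set set) set" where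
  "unital_defect T \<Gamma> tern =
    a_kernel (unital_op_ring T \<Gamma> tern) (End_ring T) (unital_reg_rep T tern)"

definition reg_image :: "('a, 'm) monoid_scheme \<Rightarrow> ('g, 'n) monoid_scheme
    \<Rightarrow> ('a \<Rightarrow> 'g \<Rightarrow> 'a \<Rightarrow> 'g \<Rightarrow> 'a \<Rightarrow> 'a) \<Rightarrow> ('a \<Rightarrow> 'a) ring" where
  "reg_image T \<Gamma> tern =
    (End_ring T)\<lparr>carrier := unital_reg_rep T tern ` carrier (unital_op_ring T \<Gamma> tern)\<rparr>"

text \<open>Powers of the unital defect are taken in the library's monoid of ideals.\<close>

definition defect_power :: "('a, 'm) monoid_scheme \<Rightarrow> ('g, 'n) monoid_scheme
    \<Rightarrow> ('a \<Rightarrow> 'g \<Rightarrow> 'a \<Rightarrow> 'g \<Rightarrow> 'a \<Rightarrow> 'a) \<Rightarrow> nat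
    \<Rightarrow> (int \<times> ('a \<times> 'g \<times> 'a \<times> 'g \<Rightarrow>\<^sub>0 int) set set) set" where
  "defect_power T \<Gamma> tern n =
    unital_defect T \<Gamma> tern [^]\<^bsub>ideals_set (unital_op_ring T \<Gamma> tern)\<^esub> n"

text \<open>\<open>defect_layer\<close> is the additive group \<open>\<C>\<^sub>n(T,\<Gamma>) = K\<^sup>n / K\<^sup>n\<^sup>+\<^sup>1\<close>.\<close>

definition defect_layer :: "('a, 'm) monoid_scheme \<Rightarrow> ('g, 'n) monoid_scheme
    \<Rightarrow> ('a \<Rightarrow> 'g \<Rightarrow> 'a \<Rightarrow> 'g \<Rightarrow> 'a \<Rightarrow> 'a) \<Rightarrow> nat
    \<Rightarrow> ((int \<times> ('a \<times> 'g \<times> 'a \<times> 'g \<Rightarrow>\<^sub>0 int) set set) set) monoid" where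
  "defect_layer T \<Gamma> tern n =
    (add_monoid (unital_op_ring T \<Gamma> tern))\<lparr>carrier := defect_power T \<Gamma> tern n\<rparr>
      Mod defect_power T \<Gamma> tern (Suc n)"


section \<open>The ternary \<open>\<int>\<close>-ring \<open>d\<int>\<close>\<close>

text \<open>For \<open>\<Gamma> = \<int>\<close> the identification of \<open>F(T,\<int>)\<close> with \<open>T \<otimes> T\<close> sends \<open>a \<otimes> \<alpha> \<otimes> b \<otimes> \<beta>\<close> to
  \<open>\<alpha>\<beta> (a \<otimes> b)\<close>, so that the class of \<open>x \<otimes> x\<close> is the bracket \<open>[x,1,x,1]\<close>.\<close>

definition multiples_group :: "int \<Rightarrow> int monoid" where
  "multiples_group d = integer_group\<lparr>carrier := {k. d dvd k}\<rparr>"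

definition int_tern :: "int \<Rightarrow> int \<Rightarrow> int \<Rightarrow> int \<Rightarrow> int \<Rightarrow> int" where
  "int_tern x n y m z = n * m * x * y * z"

lemma ternary_gamma_ring_multiples:
  "ternary_gamma_ring (multiples_group d) integer_group int_tern"
proof -
  have "comm_group (multiples_group d)"
    by (rule comm_groupI)
       (auto simp: multiples_group_def integer_group_def intro: exI[of _ "- x" for x] bexI[of _ "- x" for x])
  then show ?thesis
    by (intro ternary_gamma_ring.intro ternary_gamma_ring_axioms.intro abelian_integer_group)
       (auto simp: multiples_group_def int_tern_def integer_group_def algebra_simps)
qed

end

theory Submission
  imports Defs "HOL-Library.Product_Plus"
begin

text \<open>By biadditivity, the tensor product \<open>d\<int> \<otimes> \<int> \<otimes> d\<int> \<otimes> \<int>\<close> is infinite cyclic on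
  \<open>d \<otimes> 1 \<otimes> d \<otimes> 1\<close>, and the coordinates of \<open>(a\<alpha>b\<beta>c) \<otimes> \<gamma> \<otimes> e \<otimes> \<delta>\<close> and
  \<open>a \<otimes> \<alpha> \<otimes> (b\<beta>c\<gamma>e) \<otimes> \<delta>\<close> agree.  Hence passing to \<open>\<O>\<close> kills nothing further:
  \<open>\<O>\<close> is \<open>\<int>t\<close> with \<open>(kt)(lt) = d\<^sup>2klt\<close>, and \<open>kt\<close> acts on \<open>d\<int>\<close> as multiplication by \<open>d\<^sup>2k\<close>.
  In the unitalization the pair \<open>(n, kt)\<close> acts as \<open>n + d\<^sup>2k\<close>, so the defect consists of the
  pairs \<open>(-d\<^sup>2k, kt)\<close>.  It is the principal ideal of \<open>\<kappa>\<close>, its powers are the principal ideals of the powers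
  of \<open>\<kappa>\<close>, and \<open>\<kappa>\<^sup>2 = -d\<^sup>2\<kappa>\<close>.\<close>

section \<open>Formal integer combinations\<close>

text \<open>The homomorphism from the free abelian group to \<int> that extends \<open>w\<close>, in
  explicit form.\<close>

definition frag_eval :: "('a \<Rightarrow> int) \<Rightarrow> ('a \<Rightarrow>\<^sub>0 int) \<Rightarrow> int" where
  "frag_eval w p = (\<Sum>u\<in>Poly_Mapping.keys p. Poly_Mapping.lookup p u * w u)"

lemma frag_eval_of [simp]: "frag_eval w (frag_of u) = w u"
  by (simp add: frag_eval_def)

lemma frag_eval_0 [simp]: "frag_eval w 0 = 0"
  by (simp add: frag_eval_def)

text \<open>Puts sums over different supports on a common index set, which is how additivity is
  proved.\<close>

lemma frag_eval_superset:
  assumes "finite A" "Poly_Mapping.keys p \<subseteq> A"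
  shows "frag_eval w p = (\<Sum>u\<in>A. Poly_Mapping.lookup p u * w u)"
  unfolding frag_eval_def by (rule sum.mono_neutral_left) (use assms in \<open>auto simp: in_keys_iff\<close>)

lemma frag_eval_diff: "frag_eval w (p - q) = frag_eval w p - frag_eval w q"
proof -
  let ?A = "Poly_Mapping.keys p \<union> Poly_Mapping.keys q"
  show ?thesis
    using keys_diff[of p q]
    by (simp add: frag_eval_superset[of ?A] lookup_minus left_diff_distrib sum_subtractf)
qed

lemma frag_eval_minus: "frag_eval w (- p) = - frag_eval w p"
  using frag_eval_diff[of w 0 p] by simp

lemma frag_eval_add: "frag_eval w (p + q) = frag_eval w p + frag_eval w q"
  using frag_eval_diff[of w p "- q"] by (simp add: frag_eval_minus)

lemma frag_eval_cmul: "frag_eval w (frag_cmul c p) = c * frag_eval w p"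
  by (cases "c = 0") (simp_all add: frag_eval_superset[of "Poly_Mapping.keys p"] keys_cmul sum_distrib_left mult.assoc)

lemma frag_eval_sum: "frag_eval w (sum f I) = (\<Sum>i\<in>I. frag_eval w (f i))"
  by (induction I rule: infinite_finite_induct) (simp_all add: frag_eval_add)

text \<open>Turns the product of \<open>quad_rng\<close>, two nested extensions from generators,
  into a double evaluation.\<close>

lemma frag_eval_extend: "frag_eval w (frag_extend f p) = frag_eval (\<lambda>u. frag_eval w (f u)) p"
  by (simp add: frag_extend_def frag_eval_sum frag_eval_cmul frag_eval_def[of "\<lambda>u. frag_eval w (f u)"])

lemma frag_eval_cong:
  assumes "Poly_Mapping.keys p \<subseteq> S" "\<And>u. u \<in> S \<Longrightarrow> w u = w' u"
  shows "frag_eval w p = frag_eval w' p"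
  unfolding frag_eval_def by (rule sum.cong) (use assms in auto)

lemma frag_eval_scale_left: "frag_eval (\<lambda>u. c * w u) p = c * frag_eval w p"
  by (simp add: frag_eval_def sum_distrib_left mult.left_commute)

lemma frag_eval_scale_right: "frag_eval (\<lambda>u. w u * c) p = frag_eval w p * c"
  by (simp add: frag_eval_def sum_distrib_right mult.assoc)

text \<open>Modulo \<open>N\<close>, \<open>f\<close> is a homomorphism on \<int> and hence fixed by
  its value at 1. Each slot of a tensor is such an \<open>f\<close>, with \<open>N\<close> the
  subgroup of relations.\<close>

lemma additive_mod_subgroup:
  fixes f :: "int \<Rightarrow> 'a \<Rightarrow>\<^sub>0 int"
  assumes diff: "\<And>p q. \<lbrakk>p \<in> N; q \<in> N\<rbrakk> \<Longrightarrow> p - q \<in> N"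
    and add: "\<And>x y. f (x + y) - f x - f y \<in> N"
  shows "f n - frag_cmul n (f 1) \<in> N"
proof (induction n rule: int_induct[where k = 0])
  case base
  \<comment> \<open>This element is \<open>- f 0\<close>; with \<open>x = - f 0\<close>, the
    difference \<open>(x - x) - x\<close> is \<open>f 0\<close>.\<close>
  have "f 0 - f 0 - f 0 \<in> N" using add[of 0 0] by simp
  from diff[OF diff[OF this this] this] show ?case by simp
next
  case (step1 n)
  have zero: "0 \<in> N" using diff[OF add[of 0 0] add[of 0 0]] by simp
  have "f (n + 1) - f n - f 1 - (0 - (f n - frag_cmul n (f 1))) \<in> N"
    by (intro diff add step1 zero)
  then show ?case by (simp add: frag_cmul_distrib algebra_simps)
next
  case (step2 n)
  have "f n - frag_cmul n (f 1) - (f (n - 1 + 1) - f (n - 1) - f 1) \<in> N"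
    by (intro diff add step2)
  then show ?case by (simp add: frag_cmul_diff_distrib algebra_simps)
qed

section \<open>Images of abelian groups\<close>

text \<open>Homomorphisms preserve powers, and \<open>n\<close> is the \<open>n\<close>-th power of
  1 in \<int>.\<close>

lemma (in abelian_group) add_pow_additive:
  fixes n :: int
  assumes "\<And>m. h m \<in> carrier G" "\<And>m n. h (m + n) = h m \<oplus> h n"
  shows "add_pow G n (h 1) = h n"
proof -
  have "h \<in> hom integer_group (add_monoid G)"
    using assms by (simp add: hom_def)
  then have "h (1 [^]\<^bsub>integer_group\<^esub> n) = h 1 [^]\<^bsub>add_monoid G\<^esub> n"
    by (rule hom_int_pow) simp_all
  then show ?thesis
    by (simp add: add_pow_def)
qed

text \<open>F, \<O>, the endomorphism ring and the unitalization are all additively images of \<int>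
  or of pairs of integers. The group laws and integer multiples are then read off from the
  coordinates instead of from nested cosets.\<close>

locale additive_image =
  fixes R (structure) and f :: "'g::ab_group_add \<Rightarrow> 'r"
  assumes carrier_image: "carrier R = range f"
    and add_image: "f x \<oplus> f y = f (x + y)"
    and zero_image: "\<zero> = f 0"

sublocale additive_image \<subseteq> abelian_group R
proof (rule abelian_groupI)
  show "\<exists>y\<in>carrier R. y \<oplus> x = \<zero>" if x: "x \<in> carrier R" for x
  proof -
    obtain a where "x = f a" using x by (auto simp: carrier_image)
    then have "f (- a) \<oplus> x = \<zero>" by (simp add: add_image zero_image)
    then show ?thesis by (auto simp: carrier_image)
  qed
qed (auto simp: carrier_image add_image zero_image ac_simps)

context additive_image
begin

lemma image_closed [simp]: "f x \<in> carrier R"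
  by (simp add: carrier_image)

lemma a_inv_image: "\<ominus> f x = f (- x)"
  by (rule minus_equality) (simp_all add: add_image zero_image)

lemma a_minus_image: "f x \<ominus> f y = f (x - y)"
  by (simp add: a_minus_def a_inv_image add_image)

lemma add_pow_image:
  fixes n :: int
  assumes "\<And>m n. h (m + n) = h m + h n"
  shows "add_pow R n (f (h 1)) = f (h n)"
  by (rule add_pow_additive) (simp_all add: add_image assms)

end

section \<open>The operator ring of the multiples of d\<close>

abbreviation quads :: "int \<Rightarrow> (int \<times> int \<times> int \<times> int) set" where
  "quads d \<equiv> {k. d dvd k} \<times> UNIV \<times> {k. d dvd k} \<times> UNIV"

abbreviation multiples_quad_rng :: "int \<Rightarrow> (int \<times> int \<times> int \<times> int \<Rightarrow>\<^sub>0 int) ring" where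
  "multiples_quad_rng d \<equiv> quad_rng (multiples_group d) integer_group int_tern"

abbreviation multiples_tensor_rng :: "int \<Rightarrow> (int \<times> int \<times> int \<times> int \<Rightarrow>\<^sub>0 int) set ring" where
  "multiples_tensor_rng d \<equiv> tensor_rng (multiples_group d) integer_group int_tern"

abbreviation multiples_op_rng :: "int \<Rightarrow> (int \<times> int \<times> int \<times> int \<Rightarrow>\<^sub>0 int) set set ring" where
  "multiples_op_rng d \<equiv> op_rng (multiples_group d) integer_group int_tern"

lemma multiples_group_simps [simp]:
  "carrier (multiples_group d) = {k. d dvd k}"
  "x \<otimes>\<^bsub>multiples_group d\<^esub> y = x + y"
  "\<one>\<^bsub>multiples_group d\<^esub> = 0"
  by (simp_all add: multiples_group_def)

lemma multiples_quad_rng_simps [simp]: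
  "p \<in> carrier (multiples_quad_rng d) \<longleftrightarrow> Poly_Mapping.keys p \<subseteq> quads d"
  "p \<oplus>\<^bsub>multiples_quad_rng d\<^esub> q = p + q"
  "\<zero>\<^bsub>multiples_quad_rng d\<^esub> = 0"
  by (simp_all add: quad_rng_def)

lemma add_monoid_multiples_quad_rng: "add_monoid (multiples_quad_rng d) = free_Abelian_group (quads d)"
  by (simp add: quad_rng_def free_Abelian_group_def)

text \<open>The tensor product is free on \<open>d \<otimes> 1 \<otimes> d \<otimes> 1\<close>, and \<open>coord\<close> is the coordinate with respect
  to this generator.\<close>

definition quad_coord :: "int \<Rightarrow> int \<times> int \<times> int \<times> int \<Rightarrow> int" where
  "quad_coord d = (\<lambda>(a, \<alpha>, b, \<beta>). (a div d) * \<alpha> * (b div d) * \<beta>)"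

definition coord :: "int \<Rightarrow> (int \<times> int \<times> int \<times> int \<Rightarrow>\<^sub>0 int) \<Rightarrow> int" where
  "coord d = frag_eval (quad_coord d)"

text \<open>The formal combinations that represent \<open>k\<close> times the generator; these sets
  turn out to be the elements of the tensor product.\<close>

definition fiber :: "int \<Rightarrow> int \<Rightarrow> (int \<times> int \<times> int \<times> int \<Rightarrow>\<^sub>0 int) set" where
  "fiber d k = {p. Poly_Mapping.keys p \<subseteq> quads d \<and> coord d p = k}"

lemma coord_simps [simp]:
  "coord d 0 = 0" "coord d (p + q) = coord d p + coord d q"
  "coord d (p - q) = coord d p - coord d q" "coord d (- p) = - coord d p"
  "coord d (frag_cmul c p) = c * coord d p"
  "coord d (frag_of (a, \<alpha>, b, \<beta>)) = (a div d) * \<alpha> * (b div d) * \<beta>"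
  by (simp_all add: coord_def frag_eval_add frag_eval_diff frag_eval_minus frag_eval_cmul quad_coord_def)

lemma frag_cmul_minus_right: "frag_cmul c (p - q) = frag_cmul c p - frag_cmul c q"
  by (simp add: right_diff_distrib lookup_minus poly_mapping_eqI)

text \<open>The coordinate kills every relation; conversely, modulo the relations, each combination
  is its coordinate times \<open>d \<otimes> 1 \<otimes> d \<otimes> 1\<close>, so coordinate 0
  forces it into the relation subgroup.\<close>

lemma tensor_null_multiples:
  assumes "d > 0"
  shows "tensor_null (multiples_group d) integer_group int_tern = fiber d 0"
proof
  let ?G = "free_Abelian_group (quads d)"
  let ?N = "tensor_null (multiples_group d) integer_group int_tern"
  interpret G: group ?G by simp
  have N: "?N = generate ?G (tensor_rels (multiples_group d) integer_group)"
    by (simp only: tensor_null_def add_monoid_multiples_quad_rng)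
  have sub: "subgroup (fiber d 0) ?G"
  proof (rule G.subgroupI)
    have "0 \<in> fiber d 0" by (simp add: fiber_def)
    then show "fiber d 0 \<noteq> {}" by blast
  qed (use keys_add in \<open>fastforce simp: fiber_def\<close>)+
  have keys3: "Poly_Mapping.keys (frag_of u - frag_of v - frag_of w) \<subseteq> quads d"
    if "u \<in> quads d" "v \<in> quads d" "w \<in> quads d" for u v w :: "int \<times> int \<times> int \<times> int"
    using that keys_diff[of "frag_of u - frag_of v" "frag_of w"] keys_diff[of "frag_of u" "frag_of v"]
    by (simp only: keys_frag_of) blast
  \<comment> \<open>On multiples of \<open>d\<close> the map \<open>a div d\<close> is additive, so
    the coordinate is additive in each slot.\<close>
  have rels: "tensor_rels (multiples_group d) integer_group \<subseteq> fiber d 0"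
    unfolding tensor_rels_def
    by (intro Un_least; clarify)
       (simp add: fiber_def keys3 distrib_left distrib_right div_plus_div_distrib_dvd_left)+
  show "?N \<subseteq> fiber d 0"
    unfolding N by (rule G.generate_subgroup_incl[OF rels sub])
  have Nsub: "subgroup ?N ?G"
    unfolding N by (rule G.generate_is_subgroup) (use rels in \<open>auto simp: fiber_def\<close>)
  have keysN: "Poly_Mapping.keys p \<subseteq> quads d" if "p \<in> ?N" for p
    using subsetD[OF subgroup.subset[OF Nsub] that] unfolding carrier_free_Abelian_group_iff .
  have diff: "p - q \<in> ?N" if "p \<in> ?N" "q \<in> ?N" for p q
    using subgroup.m_closed[OF Nsub that(1) subgroup.m_inv_closed[OF Nsub that(2)]] keysN[OF that(2)]
    by simp
  have zero: "0 \<in> ?N" using subgroup.one_closed[OF Nsub] by simp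
  have cmul: "frag_cmul c p \<in> ?N" if "p \<in> ?N" for c p
    by (rule frag_closure_minus_cmul[where P = "\<lambda>p. p \<in> ?N"]) (use zero diff that in auto)
  have add: "p + q \<in> ?N" if "p \<in> ?N" "q \<in> ?N" for p q
    using diff[OF that(1) diff[OF zero that(2)]] by simp
  \<comment> \<open>Chains two congruences modulo the relations; the integer factors
    multiply.\<close>
  have trans: "p - frag_cmul (c * c') r \<in> ?N" if "p - frag_cmul c q \<in> ?N" "q - frag_cmul c' r \<in> ?N" for p q r c c'
    using add[OF that(1) cmul[OF that(2), of c]] by (simp add: frag_cmul_minus_right del: minus_frag_cmul)
  have relN: "p \<in> ?N" if "p \<in> tensor_rels (multiples_group d) integer_group" for p
    using that unfolding N by (rule generate.incl)
  note rels_defs = tensor_rels_def multiples_group_simps carrier_integer_group mult_integer_group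
  \<comment> \<open>Slots one and three range over multiples of \<open>d\<close>, so they are
    parametrized as \<open>d * n\<close> to obtain a map on \<int>; slots two and four already range
    over \<int>.\<close>
  have 1: "frag_of (d * n, \<alpha>, b, \<beta>) - frag_cmul n (frag_of (d, \<alpha>, b, \<beta>)) \<in> ?N" if "d dvd b" for n \<alpha> b \<beta>
  proof -
    have "frag_of (d * x + d * y, \<alpha>, b, \<beta>) - frag_of (d * x, \<alpha>, b, \<beta>) - frag_of (d * y, \<alpha>, b, \<beta>) \<in> ?N" for x y
      by (rule relN, unfold rels_defs, intro UnI1 CollectI exI, rule conjI, rule refl) (simp add: that)
    then show ?thesis
      using additive_mod_subgroup[of ?N "\<lambda>n. frag_of (d * n, \<alpha>, b, \<beta>)" n, OF diff]
      by (simp add: distrib_left)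
  qed
  have 2: "frag_of (a, n, b, \<beta>) - frag_cmul n (frag_of (a, 1, b, \<beta>)) \<in> ?N" if "d dvd a" "d dvd b" for n a b \<beta>
  proof (rule additive_mod_subgroup[of ?N "\<lambda>n. frag_of (a, n, b, \<beta>)" n, OF diff])
    show "frag_of (a, x + y, b, \<beta>) - frag_of (a, x, b, \<beta>) - frag_of (a, y, b, \<beta>) \<in> ?N" for x y
      by (rule relN, unfold rels_defs, rule UnI1, rule UnI1, rule UnI2, intro CollectI exI, rule conjI, rule refl)
         (simp add: that)
  qed
  have 3: "frag_of (a, \<alpha>, d * n, \<beta>) - frag_cmul n (frag_of (a, \<alpha>, d, \<beta>)) \<in> ?N" if "d dvd a" for n a \<alpha> \<beta>
  proof -
    have "frag_of (a, \<alpha>, d * x + d * y, \<beta>) - frag_of (a, \<alpha>, d * x, \<beta>) - frag_of (a, \<alpha>, d * y, \<beta>) \<in> ?N" for x y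
      by (rule relN, unfold rels_defs, rule UnI1, rule UnI2, intro CollectI exI, rule conjI, rule refl)
         (simp add: that)
    then show ?thesis
      using additive_mod_subgroup[of ?N "\<lambda>n. frag_of (a, \<alpha>, d * n, \<beta>)" n, OF diff]
      by (simp add: distrib_left)
  qed
  have 4: "frag_of (a, \<alpha>, b, n) - frag_cmul n (frag_of (a, \<alpha>, b, 1)) \<in> ?N" if "d dvd a" "d dvd b" for n a b \<alpha>
  proof (rule additive_mod_subgroup[of ?N "\<lambda>n. frag_of (a, \<alpha>, b, n)" n, OF diff])
    show "frag_of (a, \<alpha>, b, x + y) - frag_of (a, \<alpha>, b, x) - frag_of (a, \<alpha>, b, y) \<in> ?N" for x y
      by (rule relN, unfold rels_defs, rule UnI2, intro CollectI exI, rule conjI, rule refl)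
         (simp add: that)
  qed
  \<comment> \<open>The integers are pulled out slot by slot; their product is the
    coordinate.\<close>
  have gen: "frag_of u - frag_cmul (coord d (frag_of u)) (frag_of (d, 1, d, 1)) \<in> ?N" if u: "u \<in> quads d" for u
  proof -
    obtain a \<alpha> b \<beta> where u': "u = (d * a, \<alpha>, d * b, \<beta>)"
      using u by (auto simp: dvd_def)
    have dvd: "d dvd d * b" by simp
    show ?thesis
      using trans[OF trans[OF trans[OF 1[OF dvd, of a \<alpha> \<beta>] 2[OF dvd_refl dvd]] 3[OF dvd_refl]] 4[OF dvd_refl dvd_refl]] assms
      by (simp add: u')
  qed
  have cong: "p - frag_cmul (coord d p) (frag_of (d, 1, d, 1)) \<in> ?N" if "Poly_Mapping.keys p \<subseteq> quads d" for p
    using that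
  proof (induction p rule: frag_induction)
    case (diff p q)
    from \<open>\<And>p q. p \<in> ?N \<Longrightarrow> q \<in> ?N \<Longrightarrow> p - q \<in> ?N\<close>[OF diff] show ?case
      by (simp add: frag_cmul_diff_distrib algebra_simps)
  qed (use gen zero in auto)
  show "fiber d 0 \<subseteq> ?N"
  proof
    fix p assume "p \<in> fiber d 0"
    then show "p \<in> ?N" using cong[of p] by (simp add: fiber_def)
  qed
qed

text \<open>The witness is \<open>k\<close> times the generator. Having an element is what makes
  \<open>k\<close> recoverable from \<open>fiber d k\<close>.\<close>

lemma fiber_nonempty:
  assumes "d > 0"
  obtains p where "p \<in> fiber d k"
proof
  show "frag_cmul k (frag_of (d, 1, d, 1)) \<in> fiber d k"
    unfolding fiber_def
  proof (intro CollectI conjI)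
    show "Poly_Mapping.keys (frag_cmul k (frag_of (d, 1, d, 1))) \<subseteq> quads d"
      by (rule order_trans[OF keys_cmul]) simp
    show "coord d (frag_cmul k (frag_of (d, 1, d, 1))) = k"
      using assms by simp
  qed
qed

lemma fiber_eq_iff [simp]:
  assumes "d > 0"
  shows "fiber d k = fiber d l \<longleftrightarrow> k = l"
proof
  assume eq: "fiber d k = fiber d l"
  obtain p where "p \<in> fiber d k" using fiber_nonempty[OF assms] .
  moreover from this have "p \<in> fiber d l" unfolding eq .
  ultimately show "k = l" by (simp add: fiber_def)
qed simp

text \<open>The cosets of the kernel of a homomorphism are its fibers.\<close>

lemma coset_tensor_null:
  assumes "d > 0" "Poly_Mapping.keys p \<subseteq> quads d"
  shows "tensor_null (multiples_group d) integer_group int_tern +>\<^bsub>multiples_quad_rng d\<^esub> p = fiber d (coord d p)"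
proof -
  have "q \<in> fiber d (coord d p) \<Longrightarrow> q - p \<in> fiber d 0" for q
    using keys_diff[of q p] assms(2) by (auto simp: fiber_def)
  moreover have "q + p \<in> fiber d (coord d p)" if "q \<in> fiber d 0" for q
    using that keys_add[of q p] assms(2) by (auto simp: fiber_def)
  ultimately show ?thesis
    unfolding tensor_null_multiples[OF assms(1)] a_r_coset_def' multiples_quad_rng_simps
    by (force intro: bexI[of _ "q - p" for q])
qed

text \<open>The first slot of a product of quads contains three multiples of \<open>d\<close>; the
  coordinate divides out only one \<open>d\<close> there, which leaves the factor
  \<open>d\<^sup>2\<close>.\<close>

lemma coord_quad_mult:
  assumes "d > 0" "Poly_Mapping.keys p \<subseteq> quads d" "Poly_Mapping.keys q \<subseteq> quads d"
  shows "coord d (p \<otimes>\<^bsub>multiples_quad_rng d\<^esub> q) = d\<^sup>2 * coord d p * coord d q"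
proof -
  have quad: "quad_coord d (quad_mult int_tern u v) = d\<^sup>2 * quad_coord d u * quad_coord d v"
    if "u \<in> quads d" "v \<in> quads d" for u v
    using that assms(1)
    by (auto simp: dvd_def quad_coord_def int_tern_def power2_eq_square)
  have "coord d (p \<otimes>\<^bsub>multiples_quad_rng d\<^esub> q)
      = frag_eval (\<lambda>u. frag_eval (\<lambda>v. quad_coord d (quad_mult int_tern u v)) q) p"
    by (simp add: coord_def quad_rng_def frag_eval_extend)
  also have "\<dots> = frag_eval (\<lambda>u. frag_eval (\<lambda>v. d\<^sup>2 * quad_coord d u * quad_coord d v) q) p"
    by (intro frag_eval_cong[OF assms(2)] frag_eval_cong[OF assms(3)] quad)
  finally show ?thesis
    by (simp add: coord_def frag_eval_scale_left frag_eval_scale_right)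
qed

lemma quad_mult_closed:
  assumes "Poly_Mapping.keys p \<subseteq> quads d" "Poly_Mapping.keys q \<subseteq> quads d"
  shows "Poly_Mapping.keys (p \<otimes>\<^bsub>multiples_quad_rng d\<^esub> q) \<subseteq> quads d"
proof -
  have quad: "quad_mult int_tern u v \<in> quads d" if "u \<in> quads d" "v \<in> quads d" for u v
    using that by (auto simp: int_tern_def)
  have "Poly_Mapping.keys (p \<otimes>\<^bsub>multiples_quad_rng d\<^esub> q)
      \<subseteq> (\<Union>u\<in>Poly_Mapping.keys p. \<Union>v\<in>Poly_Mapping.keys q. {quad_mult int_tern u v})"
    unfolding quad_rng_def monoid.simps ring.simps
    by (rule order_trans[OF keys_frag_extend] UN_mono order_refl order_trans[OF keys_frag_extend])+ simp
  also have "\<dots> \<subseteq> quads d"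
    using quad assms by blast
  finally show ?thesis .
qed

lemma carrier_multiples_tensor_rng:
  assumes "d > 0"
  shows "carrier (multiples_tensor_rng d) = range (fiber d)"
proof -
  have "carrier (multiples_tensor_rng d)
      = (+>\<^bsub>multiples_quad_rng d\<^esub>) (tensor_null (multiples_group d) integer_group int_tern) ` {p. Poly_Mapping.keys p \<subseteq> quads d}"
    unfolding tensor_rng_def FactRing_simps partial_object.simps by (auto simp del: ring_record_simps)
  also have "\<dots> = (\<lambda>p. fiber d (coord d p)) ` {p. Poly_Mapping.keys p \<subseteq> quads d}"
    by (rule image_cong) (simp_all add: coset_tensor_null[OF assms])
  also have "\<dots> = range (fiber d)"
  proof (safe; clarsimp)
    fix k
    obtain p where "p \<in> fiber d k" using fiber_nonempty[OF assms] .
    then show "fiber d k \<in> (\<lambda>p. fiber d (coord d p)) ` {p. Poly_Mapping.keys p \<subseteq> quads d}"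
      by (auto simp: fiber_def)
  qed
  finally show ?thesis .
qed

lemma add_multiples_tensor_rng:
  assumes "d > 0"
  shows "fiber d k \<oplus>\<^bsub>multiples_tensor_rng d\<^esub> fiber d l = fiber d (k + l)"
proof -
  obtain p where p: "p \<in> fiber d l" using fiber_nonempty[OF assms] .
  have "q + r \<in> fiber d (k + l)" if "q \<in> fiber d k" "r \<in> fiber d l" for q r
    using that keys_add[of q r] by (auto simp: fiber_def)
  \<comment> \<open>Any element of the target fiber is split with one fixed \<open>p\<close> as
    second summand.\<close>
  moreover have "q - p \<in> fiber d k" if "q \<in> fiber d (k + l)" for q
    using that p keys_diff[of q p] by (auto simp: fiber_def)
  ultimately have "(\<Union>q\<in>fiber d k. \<Union>r\<in>fiber d l. {q + r}) = fiber d (k + l)"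
    using p by (force intro: bexI[of _ p] bexI[of _ "q - p" for q])
  then show ?thesis
    by (simp add: tensor_rng_def FactRing_def set_add_def')
qed

lemma zero_multiples_tensor_rng: "d > 0 \<Longrightarrow> \<zero>\<^bsub>multiples_tensor_rng d\<^esub> = fiber d 0"
  by (simp add: tensor_rng_def FactRing_def tensor_null_multiples)

lemma mult_multiples_tensor_rng:
  assumes "d > 0"
  shows "fiber d k \<otimes>\<^bsub>multiples_tensor_rng d\<^esub> fiber d l = fiber d (d\<^sup>2 * k * l)"
proof -
  obtain p q where pq: "p \<in> fiber d k" "q \<in> fiber d l" using fiber_nonempty[OF assms] by metis
  \<comment> \<open>The product of cosets is a union over all representatives; every member of the
    union is the same fiber.\<close>
  have "tensor_null (multiples_group d) integer_group int_tern +>\<^bsub>multiples_quad_rng d\<^esub> (p \<otimes>\<^bsub>multiples_quad_rng d\<^esub> q)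
      = fiber d (d\<^sup>2 * k * l)" if "p \<in> fiber d k" "q \<in> fiber d l" for p q
    using that coset_tensor_null[OF assms quad_mult_closed] coord_quad_mult[OF assms]
    by (simp add: fiber_def)
  then show ?thesis
    using pq by (auto simp: tensor_rng_def FactRing_def rcoset_mult_def)
qed

lemma additive_image_tensor: "d > 0 \<Longrightarrow> additive_image (multiples_tensor_rng d) (fiber d)"
  by unfold_locales (simp_all add: carrier_multiples_tensor_rng add_multiples_tensor_rng zero_multiples_tensor_rng)

section \<open>Passage from the tensor ring to its quotient \<O>\<close>

lemma pure_tensor_multiples:
  assumes "d > 0" "d dvd a" "d dvd b"
  shows "pure_tensor (multiples_group d) integer_group int_tern a \<alpha> b \<beta>
    = fiber d ((a div d) * \<alpha> * (b div d) * \<beta>)"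
  using coset_tensor_null[OF assms(1), of "frag_of (a, \<alpha>, b, \<beta>)"] assms
  by (simp add: pure_tensor_def)

text \<open>Every generator of the ideal is already zero in F, so the ideal is the zero
  ideal.\<close>

lemma op_null_multiples:
  assumes d: "d > 0"
  shows "op_null (multiples_group d) integer_group int_tern = {fiber d 0}"
proof -
  interpret additive_image "multiples_tensor_rng d" "fiber d" by (rule additive_image_tensor[OF d])
  define S where "S = {pure_tensor (multiples_group d) integer_group int_tern (int_tern a \<alpha> b \<beta> c) \<gamma> e \<delta>
       \<ominus>\<^bsub>multiples_tensor_rng d\<^esub> pure_tensor (multiples_group d) integer_group int_tern a \<alpha> (int_tern b \<beta> c \<gamma> e) \<delta>
      | a \<alpha> b \<beta> c \<gamma> e \<delta>.
       a \<in> carrier (multiples_group d) \<and> \<alpha> \<in> carrier integer_group \<and> b \<in> carrier (multiples_group d)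
       \<and> \<beta> \<in> carrier integer_group \<and> c \<in> carrier (multiples_group d) \<and> \<gamma> \<in> carrier integer_group
       \<and> e \<in> carrier (multiples_group d) \<and> \<delta> \<in> carrier integer_group}"
  have gen: "S \<subseteq> {fiber d 0}"
    unfolding S_def
  proof (clarsimp)
    fix a \<alpha> b \<beta> c \<gamma> e \<delta> assume dvd: "d dvd a" "d dvd b" "d dvd c" "d dvd e"
    \<comment> \<open>After division of \<open>a\<close>, \<open>b\<close>, \<open>c\<close>,
      \<open>e\<close> by \<open>d\<close>, both sides are \<open>d\<^sup>2\<close> times the
      product of the four quotients and the four scalars.\<close>
    have "int_tern a \<alpha> b \<beta> c div d * \<gamma> * (e div d) * \<delta> = a div d * \<alpha> * (int_tern b \<beta> c \<gamma> e div d) * \<delta>"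
      using dvd d by (auto simp: dvd_def int_tern_def)
    moreover have "d dvd int_tern a \<alpha> b \<beta> c" "d dvd int_tern b \<beta> c \<gamma> e"
      using dvd by (simp_all add: int_tern_def)
    ultimately show "pure_tensor (multiples_group d) integer_group int_tern (int_tern a \<alpha> b \<beta> c) \<gamma> e \<delta>
       \<ominus>\<^bsub>multiples_tensor_rng d\<^esub> pure_tensor (multiples_group d) integer_group int_tern a \<alpha> (int_tern b \<beta> c \<gamma> e) \<delta>
       = fiber d 0"
      by (simp add: pure_tensor_multiples d dvd a_minus_image)
  qed
  have "additive_subgroup {fiber d 0} (multiples_tensor_rng d)"
    using add.triv_subgroup unfolding additive_subgroup_def zero_image .
  then have ideal: "rng_ideal {fiber d 0} (multiples_tensor_rng d)"
    by (auto simp: rng_ideal_def carrier_image mult_multiples_tensor_rng[OF d])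
  have least: "fiber d 0 \<in> I" if "rng_ideal I (multiples_tensor_rng d)" for I
    using that additive_subgroup.zero_closed[of I "multiples_tensor_rng d"] by (simp add: rng_ideal_def zero_image)
  have "op_null (multiples_group d) integer_group int_tern = rng_genideal (multiples_tensor_rng d) S"
    unfolding op_null_def S_def by (rule refl)
  also have "\<dots> = {fiber d 0}"
  proof (rule antisym)
    show "rng_genideal (multiples_tensor_rng d) S \<subseteq> {fiber d 0}"
      unfolding rng_genideal_def using ideal gen by (intro Inter_lower CollectI conjI)
    show "{fiber d 0} \<subseteq> rng_genideal (multiples_tensor_rng d) S"
      unfolding rng_genideal_def
    proof (rule Inter_greatest)
      fix I assume "I \<in> {I. rng_ideal I (multiples_tensor_rng d) \<and> S \<subseteq> I}"
      then have "rng_ideal I (multiples_tensor_rng d)" by (elim CollectE conjE)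
      then show "{fiber d 0} \<subseteq> I" by (simp only: insert_subset least empty_subsetI simp_thms)
    qed
  qed
  finally show ?thesis .
qed

text \<open>The element \<open>k t\<close> of \<O>. It is a singleton because a coset of the zero
  ideal has one member.\<close>

definition op_elem :: "int \<Rightarrow> int \<Rightarrow> (int \<times> int \<times> int \<times> int \<Rightarrow>\<^sub>0 int) set set" where
  "op_elem d k = {fiber d k}"

lemma op_elem_eq_iff [simp]: "d > 0 \<Longrightarrow> op_elem d k = op_elem d l \<longleftrightarrow> k = l"
  by (simp add: op_elem_def)

lemma coset_op_null:
  assumes "d > 0"
  shows "op_null (multiples_group d) integer_group int_tern +>\<^bsub>multiples_tensor_rng d\<^esub> fiber d k = op_elem d k"
  by (simp add: a_r_coset_def' op_null_multiples op_elem_def add_multiples_tensor_rng assms)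

lemma additive_image_op:
  assumes "d > 0"
  shows "additive_image (multiples_op_rng d) (op_elem d)"
proof
  show "carrier (multiples_op_rng d) = range (op_elem d)"
  proof -
    have "carrier (multiples_op_rng d)
        = (+>\<^bsub>multiples_tensor_rng d\<^esub>) (op_null (multiples_group d) integer_group int_tern) ` carrier (multiples_tensor_rng d)"
      unfolding op_rng_def FactRing_simps partial_object.simps by auto
    then show ?thesis
      by (simp add: carrier_multiples_tensor_rng image_image coset_op_null assms)
  qed
  show "op_elem d k \<oplus>\<^bsub>multiples_op_rng d\<^esub> op_elem d l = op_elem d (k + l)" for k l
    by (simp add: op_rng_def FactRing_def set_add_def' op_elem_def add_multiples_tensor_rng assms)
  show "\<zero>\<^bsub>multiples_op_rng d\<^esub> = op_elem d 0"
    by (simp add: op_rng_def FactRing_def op_null_multiples op_elem_def assms)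
qed

lemma mult_op:
  assumes "d > 0"
  shows "op_elem d k \<otimes>\<^bsub>multiples_op_rng d\<^esub> op_elem d l = op_elem d (d\<^sup>2 * k * l)"
  using coset_op_null[OF assms, of "d\<^sup>2 * k * l"]
  by (simp add: op_rng_def FactRing_def rcoset_mult_def op_elem_def mult_multiples_tensor_rng assms)

lemma bracket_multiples:
  assumes "d > 0" "d dvd a" "d dvd b"
  shows "bracket (multiples_group d) integer_group int_tern a \<alpha> b \<beta>
    = op_elem d ((a div d) * \<alpha> * (b div d) * \<beta>)"
  by (simp add: bracket_def pure_tensor_multiples coset_op_null assms)

section \<open>The regular representation\<close>

text \<open>Restricted to the multiples of \<open>d\<close>, since members of
  \<open>End_ring\<close> are extensional; equal endomorphisms are then equal functions.\<close>

definition scaling :: "int \<Rightarrow> int \<Rightarrow> int \<Rightarrow> int" where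
  "scaling d k = (\<lambda>x\<in>{x. d dvd x}. k * x)"

lemma comm_group_multiples: "comm_group (multiples_group d)"
  using ternary_gamma_ring_multiples by (simp add: ternary_gamma_ring_def)

lemma finprod_multiples:
  assumes "finite A" "\<And>u. u \<in> A \<Longrightarrow> d dvd g u"
  shows "finprod (multiples_group d) g A = sum g A"
proof -
  interpret comm_group "multiples_group d" by (rule comm_group_multiples)
  show ?thesis
    using assms by (induction A) (simp_all add: Pi_def)
qed

lemma int_pow_multiples:
  fixes n :: int
  assumes "d dvd x"
  shows "x [^]\<^bsub>multiples_group d\<^esub> n = n * x"
proof -
  have "subgroup {k. d dvd k} integer_group"
    by (rule group.subgroupI) auto
  from group.int_pow_consistent[OF group_integer_group this, of x n] assms show ?thesis
    by (simp add: multiples_group_def)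
qed

text \<open>Powers and products in the group of multiples are ordinary multiples and sums, so the
  value at \<open>x\<close> is a \<open>frag_eval\<close>, and on each quad the weight is
  \<open>d\<^sup>2\<close> times its coordinate times \<open>x\<close>.\<close>

lemma quad_rep_multiples:
  assumes d: "d > 0" and p: "Poly_Mapping.keys p \<subseteq> quads d"
  shows "quad_rep (multiples_group d) int_tern p = scaling d (d\<^sup>2 * coord d p)"
proof -
  have "finprod (multiples_group d)
      (\<lambda>(a, \<alpha>, b, \<beta>). int_tern a \<alpha> b \<beta> x [^]\<^bsub>multiples_group d\<^esub> Poly_Mapping.lookup p (a, \<alpha>, b, \<beta>))
      (Poly_Mapping.keys p) = d\<^sup>2 * coord d p * x" if "d dvd x" for x
  proof -
    let ?w = "\<lambda>(a, \<alpha>, b, \<beta>). int_tern a \<alpha> b \<beta> x"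
    have dvd: "d dvd int_tern a \<alpha> b \<beta> x" for a \<alpha> b \<beta>
      using that by (simp add: int_tern_def)
    have w: "?w u = d\<^sup>2 * quad_coord d u * x" if "u \<in> quads d" for u
      using that d by (auto simp: dvd_def int_tern_def quad_coord_def power2_eq_square)
    have "finprod (multiples_group d)
        (\<lambda>(a, \<alpha>, b, \<beta>). int_tern a \<alpha> b \<beta> x [^]\<^bsub>multiples_group d\<^esub> Poly_Mapping.lookup p (a, \<alpha>, b, \<beta>))
        (Poly_Mapping.keys p) = frag_eval ?w p"
      by (simp add: int_pow_multiples dvd finprod_multiples split_beta frag_eval_def)
    also have "\<dots> = frag_eval (\<lambda>u. d\<^sup>2 * quad_coord d u * x) p"
      by (rule frag_eval_cong[OF p w])
    finally show ?thesis
      by (simp add: coord_def frag_eval_scale_left frag_eval_scale_right)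
  qed
  then show ?thesis
    unfolding quad_rep_def scaling_def by (auto intro: restrict_ext)
qed

text \<open>\<open>quad_rep\<close> depends only on the coordinate, hence is constant on the
  representatives of a class, and \<open>the_elem\<close> picks its single value.\<close>

lemma reg_rep_op_elem:
  assumes "d > 0"
  shows "reg_rep (multiples_group d) int_tern (op_elem d k) = scaling d (d\<^sup>2 * k)"
proof -
  obtain p where "p \<in> fiber d k" using fiber_nonempty[OF assms] .
  then have "quad_rep (multiples_group d) int_tern ` fiber d k = {scaling d (d\<^sup>2 * k)}"
    using quad_rep_multiples[OF assms] by (auto simp: fiber_def image_iff intro!: exI[of _ p])
  then show ?thesis
    by (simp add: reg_rep_def op_elem_def)
qed

lemma scaling_eq_iff [simp]:
  assumes "d > 0"
  shows "scaling d k = scaling d l \<longleftrightarrow> k = l"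
proof
  assume "scaling d k = scaling d l"
  then have "scaling d k d = scaling d l d" by simp
  with assms show "k = l" by (simp add: scaling_def)
qed simp

text \<open>The group is cyclic on \<open>d\<close>, so \<open>f\<close> is determined by
  \<open>f d\<close>, which is itself a multiple of \<open>d\<close>.\<close>

lemma hom_multiples_eq_scaling:
  assumes d: "d > 0" and f: "f \<in> hom (multiples_group d) (multiples_group d)" "f \<in> extensional {x. d dvd x}"
  shows "f = scaling d (f d div d)"
proof (rule extensionalityI[OF f(2)])
  show "scaling d (f d div d) \<in> extensional {x. d dvd x}" by (simp add: scaling_def)
  fix x assume "x \<in> {x. d dvd x}"
  then obtain n where n: "x = d * n" by auto
  interpret group_hom "multiples_group d" "multiples_group d" f
    using f(1) comm_group_multiples[of d]
    by (simp add: group_hom_def group_hom_axioms_def comm_group_def)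
  have "d dvd f d" using hom_closed[of d] by simp
  moreover have "f x = n * f d"
    using hom_int_pow[of d n] hom_closed[of d] by (simp add: int_pow_multiples n mult.commute)
  ultimately show "f x = scaling d (f d div d) x"
    by (auto simp: scaling_def n)
qed

abbreviation multiples_End_ring :: "int \<Rightarrow> (int \<Rightarrow> int) ring" where
  "multiples_End_ring d \<equiv> End_ring (multiples_group d)"

lemma additive_image_End:
  assumes d: "d > 0"
  shows "additive_image (multiples_End_ring d) (scaling d)"
proof
  have "scaling d k \<in> hom (multiples_group d) (multiples_group d) \<inter> extensional {x. d dvd x}" for k
    by (auto simp: hom_def scaling_def distrib_left)
  then show "carrier (multiples_End_ring d) = range (scaling d)"
    using hom_multiples_eq_scaling[OF d] by (fastforce simp: End_ring_def)
qed (auto simp: End_ring_def scaling_def distrib_right)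

lemma mult_End: "scaling d k \<otimes>\<^bsub>multiples_End_ring d\<^esub> scaling d l = scaling d (k * l)"
  by (auto simp: End_ring_def scaling_def compose_def)

lemma one_End: "\<one>\<^bsub>multiples_End_ring d\<^esub> = scaling d 1"
  by (auto simp: End_ring_def scaling_def)

section \<open>The unital defect\<close>

text \<open>Principal ideals multiply like their generators. At exponent 0 both sides are the whole
  ring, the unit of the monoid of ideals.\<close>

lemma (in cring) ideal_power_cgenideal:
  fixes n :: nat
  assumes a: "a \<in> carrier R"
  shows "(PIdl a) [^]\<^bsub>ideals_set R\<^esub> n = PIdl (a [^] n)"
proof (induction n)
  case 0
  then show ?case
    by (simp add: nat_pow_def ideals_set_def cgenideal_eq_genideal genideal_one)
next
  case (Suc n)
  have b: "a [^] n \<otimes> a \<in> carrier R" using a by simp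
  have "(PIdl a) [^]\<^bsub>ideals_set R\<^esub> Suc n = (PIdl (a [^] n)) \<cdot> (PIdl a)"
    using Suc.IH by (simp add: nat_pow_def ideals_set_def)
  also have "\<dots> = Idl (PIdl (a [^] n \<otimes> a))"
    using a by (simp add: ideal_prod_eq_genideal cgenideal_ideal cgenideal_prod)
  also have "\<dots> = PIdl (a [^] n \<otimes> a)"
  proof (rule antisym)
    have ideal: "ideal (PIdl (a [^] n \<otimes> a)) R"
      by (rule cgenideal_ideal[OF b])
    show "Idl (PIdl (a [^] n \<otimes> a)) \<subseteq> PIdl (a [^] n \<otimes> a)"
      by (rule genideal_minimal[OF ideal order_refl])
    show "PIdl (a [^] n \<otimes> a) \<subseteq> Idl (PIdl (a [^] n \<otimes> a))"
      using ideal.Icarr[OF ideal] by (intro genideal_self subsetI)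
  qed
  finally show ?case by simp
qed

section \<open>The unitalization in integer coordinates\<close>

abbreviation multiples_unital_op_ring :: "int \<Rightarrow> (int \<times> (int \<times> int \<times> int \<times> int \<Rightarrow>\<^sub>0 int) set set) ring" where
  "multiples_unital_op_ring d \<equiv> unital_op_ring (multiples_group d) integer_group int_tern"

definition elt :: "int \<Rightarrow> int \<Rightarrow> int \<Rightarrow> int \<times> (int \<times> int \<times> int \<times> int \<Rightarrow>\<^sub>0 int) set set" where
  "elt d n k = (n, op_elem d k)"

lemma elt_eq_iff [simp]: "d > 0 \<Longrightarrow> elt d n k = elt d m l \<longleftrightarrow> n = m \<and> k = l"
  by (simp add: elt_def)

context
  fixes d :: int
  assumes d: "d > 0"
begin

interpretation R: additive_image "multiples_op_rng d" "op_elem d"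
  by (rule additive_image_op[OF d])

interpretation E: additive_image "multiples_End_ring d" "scaling d"
  by (rule additive_image_End[OF d])

lemma add_pow_op_elem: "add_pow (multiples_op_rng d) n (op_elem d k) = op_elem d (n * k)" for n :: int
  using R.add_pow_image[of "\<lambda>n. n * k" n] by (simp add: distrib_right)

lemma add_pow_scaling: "add_pow (multiples_End_ring d) n (scaling d k) = scaling d (n * k)" for n :: int
  using E.add_pow_image[of "\<lambda>n. n * k" n] by (simp add: distrib_right)

lemma additive_image_unital: "additive_image (multiples_unital_op_ring d) (\<lambda>(n, k). elt d n k)"
  by unfold_locales
     (auto simp: unital_op_ring_def Let_def elt_def R.carrier_image R.add_image R.zero_image image_iff zero_prod_def)

interpretation A: additive_image "multiples_unital_op_ring d" "\<lambda>(n, k). elt d n k"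
  by (rule additive_image_unital)

lemma carrier_unital: "x \<in> carrier (multiples_unital_op_ring d) \<longleftrightarrow> (\<exists>n k. x = elt d n k)"
  by (auto simp: A.carrier_image)

lemma elt_closed [simp]: "elt d n k \<in> carrier (multiples_unital_op_ring d)"
  by (auto simp: carrier_unital)

lemma add_elt: "elt d n k \<oplus>\<^bsub>multiples_unital_op_ring d\<^esub> elt d m l = elt d (n + m) (k + l)"
  using A.add_image[of "(n, k)" "(m, l)"] by simp

lemma zero_elt: "\<zero>\<^bsub>multiples_unital_op_ring d\<^esub> = elt d 0 0"
  using A.zero_image by (simp add: zero_prod_def)

lemma a_inv_elt: "\<ominus>\<^bsub>multiples_unital_op_ring d\<^esub> elt d n k = elt d (- n) (- k)"
  using A.a_inv_image[of "(n, k)"] by simp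

lemma a_minus_elt: "elt d n k \<ominus>\<^bsub>multiples_unital_op_ring d\<^esub> elt d m l = elt d (n - m) (k - l)"
  using A.a_minus_image[of "(n, k)" "(m, l)"] by simp

lemma add_pow_elt: "add_pow (multiples_unital_op_ring d) c (elt d n k) = elt d (c * n) (c * k)" for c :: int
  using A.add_pow_image[of "\<lambda>c. (c * n, c * k)" c] by (simp add: distrib_right)

lemma one_elt: "\<one>\<^bsub>multiples_unital_op_ring d\<^esub> = elt d 1 0"
  by (simp add: unital_op_ring_def Let_def elt_def R.zero_image)

lemma mult_elt:
  "elt d n k \<otimes>\<^bsub>multiples_unital_op_ring d\<^esub> elt d m l = elt d (n * m) (n * l + m * k + d\<^sup>2 * k * l)"
  by (simp add: unital_op_ring_def Let_def elt_def add_pow_op_elem R.add_image mult_op d)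

text \<open>In coordinates every ring law becomes a polynomial identity over \<int>; the product
  formula is symmetric in its two factors.\<close>

lemma cring_unital: "cring (multiples_unital_op_ring d)"
proof (rule cringI)
  show "abelian_group (multiples_unital_op_ring d)" by (rule A.abelian_group_axioms)
  show "comm_monoid (multiples_unital_op_ring d)"
    by (rule comm_monoidI) (auto simp: carrier_unital mult_elt one_elt d algebra_simps)
qed (auto simp: carrier_unital mult_elt add_elt d algebra_simps)

interpretation A: cring "multiples_unital_op_ring d"
  by (rule cring_unital)

lemma unital_reg_rep_elt: "unital_reg_rep (multiples_group d) int_tern (elt d n k) = scaling d (n + d\<^sup>2 * k)"
  by (simp add: unital_reg_rep_def elt_def reg_rep_op_elem d one_End add_pow_scaling E.add_image)

text \<open>Since \<open>t\<close> annihilates \<kappa>, the factor \<open>elt d n k\<close> acts on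
  a multiple of \<kappa> as the integer \<open>n\<close>; the principal ideal therefore consists of
  integer multiples only.\<close>

lemma cgenideal_elt:
  "PIdl\<^bsub>multiples_unital_op_ring d\<^esub> (elt d (- (d\<^sup>2 * c)) c) = range (\<lambda>n. elt d (- (d\<^sup>2 * (n * c))) (n * c))"
proof -
  have mult: "elt d n k \<otimes>\<^bsub>multiples_unital_op_ring d\<^esub> elt d (- (d\<^sup>2 * c)) c = elt d (- (d\<^sup>2 * (n * c))) (n * c)" for n k
    by (simp add: mult_elt d algebra_simps)
  show ?thesis
  proof (intro equalityI subsetI)
    fix x assume "x \<in> PIdl\<^bsub>multiples_unital_op_ring d\<^esub> (elt d (- (d\<^sup>2 * c)) c)"
    then show "x \<in> range (\<lambda>n. elt d (- (d\<^sup>2 * (n * c))) (n * c))"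
      by (auto simp: cgenideal_def carrier_unital mult)
  next
    fix x assume "x \<in> range (\<lambda>n. elt d (- (d\<^sup>2 * (n * c))) (n * c))"
    then obtain n where "x = elt d n 0 \<otimes>\<^bsub>multiples_unital_op_ring d\<^esub> elt d (- (d\<^sup>2 * c)) c"
      unfolding mult by blast
    then show "x \<in> PIdl\<^bsub>multiples_unital_op_ring d\<^esub> (elt d (- (d\<^sup>2 * c)) c)"
      using elt_closed unfolding cgenideal_def by blast
  qed
qed

section \<open>The unital defect, its powers and their successive quotients\<close>

lemma unital_defect_eq: "unital_defect (multiples_group d) integer_group int_tern = range (\<lambda>n. elt d (- (d\<^sup>2 * n)) n)"
  by (auto simp: unital_defect_def a_kernel_def' carrier_unital unital_reg_rep_elt E.zero_image d
        eq_neg_iff_add_eq_0)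

lemma unital_defect_eq_cgenideal:
  "unital_defect (multiples_group d) integer_group int_tern = PIdl\<^bsub>multiples_unital_op_ring d\<^esub> (elt d (- d\<^sup>2) 1)"
  using cgenideal_elt[of 1] by (simp add: unital_defect_eq)

text \<open>The power is the principal ideal of \<open>\<kappa> ^ (m + 1)\<close>, which is
  \<open>(- d\<^sup>2) ^ m\<close> times \<kappa>; the sign does not change the set of integer
  multiples.\<close>

lemma defect_power_eq:
  "defect_power (multiples_group d) integer_group int_tern (Suc m)
    = range (\<lambda>n. elt d (- (d\<^sup>2 * (n * d ^ (2 * m)))) (n * d ^ (2 * m)))"
proof -
  let ?c = "(- (d\<^sup>2)) ^ m"
  have "elt d (- d\<^sup>2) 1 [^]\<^bsub>multiples_unital_op_ring d\<^esub> Suc m = elt d (- (d\<^sup>2 * ?c)) ?c"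
  proof (induction m)
    case 0
    show ?case by simp
  next
    case (Suc m)
    have "elt d (- d\<^sup>2) 1 [^]\<^bsub>multiples_unital_op_ring d\<^esub> Suc (Suc m)
        = elt d (- (d\<^sup>2 * (- (d\<^sup>2)) ^ m)) ((- (d\<^sup>2)) ^ m) \<otimes>\<^bsub>multiples_unital_op_ring d\<^esub> elt d (- d\<^sup>2) 1"
      using Suc.IH by simp
    then show ?case by (simp add: mult_elt d)
  qed
  then have "defect_power (multiples_group d) integer_group int_tern (Suc m)
      = range (\<lambda>n. elt d (- (d\<^sup>2 * (n * ?c))) (n * ?c))"
    by (simp only: defect_power_def unital_defect_eq_cgenideal A.ideal_power_cgenideal[OF elt_closed] cgenideal_elt)
  also have "\<dots> = range (\<lambda>n. elt d (- (d\<^sup>2 * (n * d ^ (2 * m)))) (n * d ^ (2 * m)))"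
  proof (cases "even m")
    case True
    then show ?thesis by (simp add: power_mult)
  next
    case False
    \<comment> \<open>For odd \<open>m\<close> the sign is moved onto the parameter, and negation
      permutes \<int>.\<close>
    have "range (\<lambda>n. elt d (- (d\<^sup>2 * (n * ?c))) (n * ?c))
        = range (\<lambda>n. elt d (- (d\<^sup>2 * (- n * d ^ (2 * m)))) (- n * d ^ (2 * m)))"
      using False by (simp add: power_mult)
    also have "\<dots> = (\<lambda>n. elt d (- (d\<^sup>2 * (n * d ^ (2 * m)))) (n * d ^ (2 * m))) ` range uminus"
      by (simp only: image_image)
    also have "range (uminus :: int \<Rightarrow> int) = UNIV"
      by (rule surjI[of _ uminus]) simp
    finally show ?thesis .
  qed
  finally show ?thesis .
qed

text \<open>The first isomorphism theorem, for the coordinate on the \<open>m + 1\<close>-st power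
  reduced modulo \<open>d\<^sup>2\<close>.\<close>

lemma defect_layer_iso:
  "defect_layer (multiples_group d) integer_group int_tern (Suc m) \<cong> integer_mod_group (nat (d\<^sup>2))"
proof -
  let ?K = "\<lambda>n. defect_power (multiples_group d) integer_group int_tern n"
  let ?G = "(add_monoid (multiples_unital_op_ring d))\<lparr>carrier := ?K (Suc m)\<rparr>"
  let ?H = "integer_mod_group (nat (d\<^sup>2))"
  \<comment> \<open>\<open>e n\<close> is \<open>n\<close> times the generator
    \<open>d ^ (2 * m)\<close> \<kappa>.\<close>
  define e where "e n = elt d (- (d\<^sup>2 * (n * d ^ (2 * m)))) (n * d ^ (2 * m))" for n
  \<comment> \<open>The integer component of \<open>e n\<close> is
    \<open>- n * d ^ (2 * m + 2)\<close>, so it alone recovers \<open>n\<close>.\<close>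
  define h where "h x = (- fst x div d ^ (2 * m + 2)) mod d\<^sup>2" for x :: "int \<times> (int \<times> int \<times> int \<times> int \<Rightarrow>\<^sub>0 int) set set"
  have K: "?K (Suc m) = range e"
    by (simp add: defect_power_eq e_def)
  have K': "?K (Suc (Suc m)) = range (\<lambda>n. e (n * d\<^sup>2))"
    by (simp add: defect_power_eq e_def power2_eq_square mult.assoc)
  have h: "h (e n) = n mod d\<^sup>2" for n
  proof -
    have "- fst (e n) = n * d ^ (2 * m + 2)"
      by (simp add: e_def elt_def power_add power2_eq_square)
    then show ?thesis using d by (simp add: h_def)
  qed
  have e_inj: "e n = e n' \<longleftrightarrow> n = n'" for n n'
    using d by (auto simp: e_def)
  have add: "e n \<oplus>\<^bsub>multiples_unital_op_ring d\<^esub> e n' = e (n + n')" for n n'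
    by (simp add: e_def add_elt algebra_simps)
  have zero: "\<zero>\<^bsub>multiples_unital_op_ring d\<^esub> = e 0"
    by (simp add: e_def zero_elt)
  have "subgroup (range e) (add_monoid (multiples_unital_op_ring d))"
  proof (rule A.add.subgroupI)
    show "\<ominus>\<^bsub>multiples_unital_op_ring d\<^esub> a \<in> range e" if a: "a \<in> range e" for a
    proof -
      obtain n where "a = e n" using a by blast
      then have "\<ominus>\<^bsub>multiples_unital_op_ring d\<^esub> a = e (- n)"
        by (simp add: e_def a_inv_elt)
      then show ?thesis by simp
    qed
    show "range e \<subseteq> carrier (multiples_unital_op_ring d)"
      by (auto simp: e_def)
  qed (auto simp: add simp del: split_paired_All)
  then have G: "group ?G"
    unfolding K by (rule group.subgroup_imp_group[OF A.a_group])
  have H: "carrier ?H = {0..<d\<^sup>2}"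
    using d by (simp add: carrier_integer_mod_group)
  have hom: "h \<in> hom ?G ?H"
    using d by (auto simp: hom_def K H h add mod_add_eq)
  interpret group_hom ?G ?H h
    using G hom by (simp add: group_hom_def group_hom_axioms_def)
  have "kernel ?G ?H h = ?K (Suc (Suc m))"
    using d by (auto simp: kernel_def K K' h e_inj mult.commute dvd_def)
  moreover have "h ` carrier ?G = carrier ?H"
  proof -
    have "h (e x) = x" if "x \<in> {0..<d\<^sup>2}" for x
      using that by (simp add: h)
    then have "{0..<d\<^sup>2} \<subseteq> h ` range e"
      by (metis image_eqI range_eqI subsetI)
    then show ?thesis
      using d by (auto simp: K H h)
  qed
  ultimately show ?thesis
    using FactGroup_iso unfolding defect_layer_def by metis
qed

section \<open>Image and kernel of the regular representation\<close>

lemma reg_image_iso: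
  "(\<lambda>f. f d div d) \<in> ring_iso (reg_image (multiples_group d) integer_group int_tern) \<Z>"
proof -
  \<comment> \<open>Evaluation at the generator recovers the scaling factor, so
    \<open>scaling d\<close> is the inverse map.\<close>
  have eval: "scaling d k d div d = k" for k using d by (simp add: scaling_def)
  have carrier: "carrier (reg_image (multiples_group d) integer_group int_tern) = range (scaling d)"
  proof -
    have "scaling d k = unital_reg_rep (multiples_group d) int_tern (elt d k 0)" for k
      by (simp add: unital_reg_rep_elt)
    then have "range (scaling d) \<subseteq> unital_reg_rep (multiples_group d) int_tern ` carrier (multiples_unital_op_ring d)"
      using elt_closed by blast
    then show ?thesis
      by (auto simp: reg_image_def carrier_unital unital_reg_rep_elt)
  qed
  show ?thesis
  proof (rule ring_iso_memI)
    show "bij_betw (\<lambda>f. f d div d) (carrier (reg_image (multiples_group d) integer_group int_tern)) (carrier \<Z>)"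
      unfolding carrier by (rule bij_betwI[where g = "scaling d"]) (auto simp: eval)
  qed (unfold carrier, auto simp: reg_image_def eval mult_End E.add_image one_End)
qed

lemma op_elem_iso: "op_elem d \<in> iso integer_group (add_monoid (multiples_op_rng d))"
  using d by (auto simp: iso_def hom_def R.add_image bij_betw_def inj_on_def R.carrier_image)

lemma inj_on_reg_rep: "inj_on (reg_rep (multiples_group d) int_tern) (carrier (multiples_op_rng d))"
  using d by (auto simp: inj_on_def R.carrier_image reg_rep_op_elem)

lemma regular_defect_eq:
  "regular_defect (multiples_group d) integer_group int_tern = {\<zero>\<^bsub>multiples_op_rng d\<^esub>}"
  using d by (auto simp: regular_defect_def a_kernel_def' R.carrier_image reg_rep_op_elem R.zero_image E.zero_image)

end

section \<open>The presentation by a polynomial ring\<close>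

context
  fixes d :: int
  assumes d: "d > 0"
begin

text \<open>Evaluation at \<open>t\<close> kills the quadratic. Modulo the quadratic every
  polynomial is linear, and on linear polynomials the evaluation is injective and onto, so the
  kernel is exactly \<open>I\<close>.\<close>

lemma polynomial_presentation:
  defines "P \<equiv> UP \<Z>"
  defines "X \<equiv> monom P (1 :: int) 1"
  defines "I \<equiv> Idl\<^bsub>P\<^esub> {X [^]\<^bsub>P\<^esub> (2 :: nat) \<ominus>\<^bsub>P\<^esub> add_pow P (d\<^sup>2) X}"
  shows "\<exists>\<phi> \<in> ring_iso (P Quot I) (multiples_unital_op_ring d). \<phi> (I +>\<^bsub>P\<^esub> X) = elt d 0 1"
proof -
  note One_nat_def [simp del]
  let ?A = "multiples_unital_op_ring d"
  let ?q = "X [^]\<^bsub>P\<^esub> (2 :: nat) \<ominus>\<^bsub>P\<^esub> add_pow P (d\<^sup>2) X"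
  let ?h = "\<lambda>n. elt d n 0"
  define ev where "ev = eval \<Z> ?A ?h (elt d 0 1)"
  interpret A: cring ?A by (rule cring_unital[OF d])
  have hom: "ring_hom_cring \<Z> ?A ?h"
    by (rule ring_hom_cringI[OF int_is_cring A.cring_axioms])
       (simp add: ring_hom_def mult_elt add_elt one_elt d)
  interpret U: UP_univ_prop \<Z> ?A ?h P "elt d 0 1" ev
    using hom int_is_cring
    by (intro UP_univ_prop.intro UP_univ_prop_axioms.intro UP_pre_univ_prop.intro UP_cring.intro)
       (simp_all add: P_def ev_def d)
  have ev: "ring_hom_ring P ?A ev"
    by (rule ring_hom_ringI2[OF U.P.ring_axioms A.ring_axioms U.homh])
  have monom_add: "monom P (m + n) i = monom P m i \<oplus>\<^bsub>P\<^esub> monom P n i" for m n :: int and i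
    using U.monom_add[of m n i] by simp
  have monom_mult: "monom P (m * n) (i + j) = monom P m i \<otimes>\<^bsub>P\<^esub> monom P n j" for m n :: int and i j
    using U.monom_mult[of m n i j] by simp
  have q: "?q = monom P 1 2 \<ominus>\<^bsub>P\<^esub> monom P (d\<^sup>2) 1"
  proof -
    have "add_pow P (d\<^sup>2) X = monom P (d\<^sup>2) 1"
      unfolding X_def by (rule U.P.add_pow_additive) (simp_all add: monom_add)
    moreover have "X [^]\<^bsub>P\<^esub> (2 :: nat) = monom P 1 2"
      using U.monom_pow[of 1 1 2] by (simp add: X_def)
    ultimately show ?thesis by simp
  qed
  have q_closed: "?q \<in> carrier P" unfolding q by simp
  have ev_monom: "ev (monom P n 0) = elt d n 0" "ev (monom P n 1) = elt d 0 n" for n :: int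
    using U.eval_monom[of n "elt d 0 1" 0] U.eval_monom[of n "elt d 0 1" 1]
    by (simp_all add: mult_elt d flip: ev_def)
  have ev_linear: "ev (monom P n 0 \<oplus>\<^bsub>P\<^esub> monom P k 1) = elt d n k" for n k :: int
    by (simp add: ev_monom add_elt d)
  have I: "ideal I P"
    unfolding I_def by (rule U.P.genideal_ideal) (use q_closed in simp)
  interpret I: ideal I P by (rule I)
  have qI: "?q \<in> I"
    unfolding I_def by (rule U.P.genideal_self'[OF q_closed])
  \<comment> \<open>Both terms evaluate to \<open>d\<^sup>2\<close> times \<open>t\<close>, because
    \<open>t\<close> squared is that element.\<close>
  have "ev ?q = elt d 0 0"
  proof -
    have "ev (monom P 1 2) = elt d 0 (d\<^sup>2)"
      using U.eval_monom[of 1 "elt d 0 1" 2]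
      by (simp add: mult_elt d numeral_2_eq_2 flip: ev_def)
    then show ?thesis
      unfolding q by (simp add: ev_monom a_minus_elt d a_minus_def a_inv_elt add_elt)
  qed
  then have "?q \<in> a_kernel P ?A ev"
    using q_closed by (simp only: a_kernel_def' zero_elt[OF d] mem_Collect_eq simp_thms)
  then have I_kernel: "I \<subseteq> a_kernel P ?A ev"
    unfolding I_def by (intro U.P.genideal_minimal[OF ring_hom_ring.kernel_is_ideal[OF ev]] insert_subsetI empty_subsetI)
  \<comment> \<open>Division with remainder by the monic quadratic \<open>?q\<close>: first for
    monomials, then for their sums.\<close>
  have linear: "\<exists>i\<in>I. \<exists>n k :: int. p = i \<oplus>\<^bsub>P\<^esub> (monom P n 0 \<oplus>\<^bsub>P\<^esub> monom P k 1)" (is "?linear p") if "p \<in> carrier P" for p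
  proof -
    have add: "?linear (p \<oplus>\<^bsub>P\<^esub> q)" if linear: "?linear p" "?linear q" for p q
    proof -
      obtain i n k where p: "i \<in> I" "p = i \<oplus>\<^bsub>P\<^esub> (monom P n 0 \<oplus>\<^bsub>P\<^esub> monom P k 1)"
        using linear(1) by blast
      obtain j m l where q: "j \<in> I" "q = j \<oplus>\<^bsub>P\<^esub> (monom P m 0 \<oplus>\<^bsub>P\<^esub> monom P l 1)"
        using linear(2) by blast
      have "p \<oplus>\<^bsub>P\<^esub> q = (i \<oplus>\<^bsub>P\<^esub> j) \<oplus>\<^bsub>P\<^esub> (monom P (n + m) 0 \<oplus>\<^bsub>P\<^esub> monom P (k + l) 1)"
        using p(1) q(1) by (simp add: p(2) q(2) monom_add U.P.a_ac)
      then show ?thesis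
        using p(1) q(1) by blast
    qed
    have ideal: "?linear i" if "i \<in> I" for i
      using that U.monom_zero by (intro bexI[of _ i] exI[of _ 0]) simp_all
    have monom: "?linear (monom P c i)" for c i
    proof (induction i arbitrary: c rule: less_induct)
      case (less i)
      consider "i = 0" | "i = 1" | j where "i = Suc (Suc j)"
        by (metis One_nat_def not0_implies_Suc)
      then show ?case
      proof cases
        case 1
        then show ?thesis
          using U.monom_zero by (intro bexI[of _ "\<zero>\<^bsub>P\<^esub>"] exI[of _ c] exI[of _ 0]) simp_all
      next
        case 2
        then show ?thesis
          using U.monom_zero by (intro bexI[of _ "\<zero>\<^bsub>P\<^esub>"] exI[of _ 0] exI[of _ c]) simp_all
      next
        case 3
        \<comment> \<open>Trading the square of \<open>X\<close> for \<open>d\<^sup>2\<close> times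
          \<open>X\<close> lowers the degree by one at the cost of a member of
          \<open>I\<close>.\<close>
        have "monom P c j \<otimes>\<^bsub>P\<^esub> ?q \<oplus>\<^bsub>P\<^esub> monom P (c * d\<^sup>2) (j + 1) = monom P c (j + 2)"
          using monom_mult[of c 1 j 2] monom_mult[of c "d\<^sup>2" j 1]
          unfolding q by (simp add: U.P.r_distr U.P.r_minus U.P.a_assoc U.P.l_neg a_minus_def)
        moreover have qI': "monom P c j \<otimes>\<^bsub>P\<^esub> ?q \<in> I"
          using qI by (intro I.I_l_closed) simp_all
        moreover have "i = j + 2" "j + 1 < i" using 3 by simp_all
        ultimately show ?thesis
          using add[OF ideal[OF qI'] less.IH[of "j + 1" "c * d\<^sup>2"]] by (simp only:)
      qed
    qed
    have "?linear (\<Oplus>\<^bsub>P\<^esub>i\<in>J. monom P (coeff P p i) i)" if "finite J" for J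
      using that
    proof (induction J)
      case empty
      show ?case using ideal[OF I.zero_closed] by simp
    next
      case (insert i J)
      then show ?case using add[OF monom insert.IH] by simp
    qed
    from this[of "{..deg \<Z> p}"] show ?thesis
      using U.up_repr[OF that] by simp
  qed
  have kernelD: "p \<in> carrier P" "ev p = elt d 0 0" if "p \<in> a_kernel P ?A ev" for p
    using that unfolding a_kernel_def' zero_elt[OF d] by (rule CollectE, blast)+
  have kernel: "a_kernel P ?A ev = I"
  proof (intro equalityI subsetI)
    fix p assume "p \<in> a_kernel P ?A ev"
    note p = kernelD[OF this]
    obtain i n k where i: "i \<in> I" and p_eq: "p = i \<oplus>\<^bsub>P\<^esub> (monom P n 0 \<oplus>\<^bsub>P\<^esub> monom P k 1)"
      using linear[OF p(1)] by blast
    have "ev i = elt d 0 0"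
      by (rule kernelD(2)[OF subsetD[OF I_kernel i]])
    then have "ev p = elt d n k"
      using i by (simp add: p_eq ev_monom add_elt d)
    \<comment> \<open>The linear remainder of a polynomial in the kernel has both coefficients zero,
      which leaves \<open>p = i\<close>.\<close>
    then have "elt d n k = elt d 0 0"
      using p(2) by (rule trans[OF sym])
    then have "n = 0" "k = 0"
      unfolding elt_eq_iff[OF d] by simp_all
    then show "p \<in> I"
      using i U.monom_zero by (simp add: p_eq)
  next
    fix p assume "p \<in> I"
    then show "p \<in> a_kernel P ?A ev" by (rule subsetD[OF I_kernel])
  qed
  have surj: "ev ` carrier P = carrier ?A"
  proof (intro equalityI subsetI)
    fix x assume "x \<in> carrier ?A"
    then obtain n k where "x = elt d n k"
      using carrier_unital[OF d] by blast
    then have "x = ev (monom P n 0 \<oplus>\<^bsub>P\<^esub> monom P k 1)"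
      by (simp only: ev_linear)
    then show "x \<in> ev ` carrier P" by (rule image_eqI[where f = ev]) simp
  next
    fix x assume "x \<in> ev ` carrier P"
    then show "x \<in> carrier ?A" by (rule imageE) simp
  qed
  have "(\<lambda>Y. the_elem (ev ` Y)) \<in> ring_iso (P Quot I) ?A"
    using ring_hom_ring.FactRing_iso_set[OF ev surj] by (simp only: kernel)
  moreover have "the_elem (ev ` (I +>\<^bsub>P\<^esub> X)) = elt d 0 1"
  proof -
    have X: "X \<in> carrier P" "ev X = elt d 0 1"
      using ev_monom(2)[of 1] by (simp_all add: X_def)
    \<comment> \<open>\<open>ev\<close> kills \<open>I\<close>, so it is constant on the coset of
      \<open>X\<close> and the induced map sends that coset to \<open>t\<close>.\<close>
    have ev_coset: "ev y = elt d 0 1" if "y \<in> I +>\<^bsub>P\<^esub> X" for y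
    proof -
      obtain i where i: "i \<in> I" and y: "y = i \<oplus>\<^bsub>P\<^esub> X"
        using \<open>y \<in> I +>\<^bsub>P\<^esub> X\<close> unfolding a_r_coset_def' by blast
      have "ev i = elt d 0 0"
        by (rule kernelD(2)[OF subsetD[OF I_kernel i]])
      then show ?thesis
        using i X by (simp add: y add_elt d)
    qed
    have "I +>\<^bsub>P\<^esub> X \<noteq> {}"
      using I.a_rcos_self[OF X(1)] by blast
    then have "ev ` (I +>\<^bsub>P\<^esub> X) = {elt d 0 1}"
      by (simp add: ev_coset image_constant_conv cong: image_cong)
    then show ?thesis
      by (simp only: the_elem_eq)
  qed
  ultimately show ?thesis
    by (intro bexI[of _ "\<lambda>Y. the_elem (ev ` Y)"])
qed

end

theorem theorem15p1:
  fixes d :: int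
  assumes d: "d \<ge> 2"
  defines "T \<equiv> multiples_group d"
    and "R \<equiv> op_rng (multiples_group d) integer_group int_tern"
    and "A \<equiv> unital_op_ring (multiples_group d) integer_group int_tern"
    and "E \<equiv> End_ring (multiples_group d)"
    and "\<rho> \<equiv> reg_rep (multiples_group d) int_tern"
    and "\<rho>1 \<equiv> unital_reg_rep (multiples_group d) int_tern"
    and "K \<equiv> unital_defect (multiples_group d) integer_group int_tern"
    and "t \<equiv> bracket (multiples_group d) integer_group int_tern d 1 d 1"
  defines "tA \<equiv> (0 :: int, t)"
  defines "\<kappa> \<equiv> tA \<ominus>\<^bsub>A\<^esub> add_pow A (d\<^sup>2) \<one>\<^bsub>A\<^esub>"
  defines "P \<equiv> UP \<Z>"
  defines "X \<equiv> monom P (1 :: int) 1"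
  defines "I \<equiv> Idl\<^bsub>P\<^esub> {X [^]\<^bsub>P\<^esub> (2 :: nat) \<ominus>\<^bsub>P\<^esub> add_pow P (d\<^sup>2) X}"
  shows "(\<lambda>k :: int. add_pow R k t) \<in> iso integer_group (add_monoid R)
    \<and> t \<otimes>\<^bsub>R\<^esub> t = add_pow R (d\<^sup>2) t
    \<and> inj_on \<rho> (carrier R)
    \<and> \<rho> t = add_pow E (d\<^sup>2) \<one>\<^bsub>E\<^esub>
    \<and> regular_defect T integer_group int_tern = {\<zero>\<^bsub>R\<^esub>}
    \<and> (\<exists>\<phi> \<in> ring_iso (P Quot I) A. \<phi> (I +>\<^bsub>P\<^esub> X) = tA)
    \<and> (\<exists>\<psi> \<in> ring_iso (reg_image T integer_group int_tern) \<Z>. \<psi> (\<rho>1 tA) = d\<^sup>2)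
    \<and> K = Idl\<^bsub>A\<^esub> {\<kappa>}
    \<and> \<kappa> \<otimes>\<^bsub>A\<^esub> \<kappa> = \<ominus>\<^bsub>A\<^esub> add_pow A (d\<^sup>2) \<kappa>
    \<and> (\<forall>n \<ge> 1. defect_power T integer_group int_tern n
          = (\<lambda>k. add_pow A (d ^ (2 * (n - 1))) k) ` K)
    \<and> (\<forall>n \<ge> 1. defect_layer T integer_group int_tern n \<cong> integer_mod_group (nat (d\<^sup>2)))"
proof -
  have d0: "d > 0" using d by simp
  interpret A: cring A unfolding A_def by (rule cring_unital[OF d0])
  \<comment> \<open>The coordinate of \<open>[d,1,d,1]\<close> is 1, as
    \<open>d div d = 1\<close>.\<close>
  have t: "t = op_elem d 1"
    using d0 by (simp add: t_def bracket_multiples)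
  have tA: "tA = elt d 0 1"
    by (simp add: tA_def t elt_def)
  have \<kappa>: "\<kappa> = elt d (- d\<^sup>2) 1"
    by (simp add: \<kappa>_def tA A_def one_elt add_pow_elt a_minus_elt d0)
  \<comment> \<open>The map sending \<open>k\<close> to \<open>k t\<close> is
    \<open>op_elem d\<close> itself.\<close>
  have 1: "(\<lambda>k :: int. add_pow R k t) \<in> iso integer_group (add_monoid R)"
    using op_elem_iso[OF d0] by (simp add: R_def t add_pow_op_elem d0 eta_contract_eq)
  have 2: "t \<otimes>\<^bsub>R\<^esub> t = add_pow R (d\<^sup>2) t"
    by (simp add: R_def t mult_op add_pow_op_elem d0)
  have 3: "inj_on \<rho> (carrier R)"
    unfolding \<rho>_def R_def by (rule inj_on_reg_rep[OF d0])
  have 4: "\<rho> t = add_pow E (d\<^sup>2) \<one>\<^bsub>E\<^esub>"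
    by (simp add: \<rho>_def t E_def reg_rep_op_elem one_End add_pow_scaling d0)
  have 5: "regular_defect T integer_group int_tern = {\<zero>\<^bsub>R\<^esub>}"
    unfolding T_def R_def by (rule regular_defect_eq[OF d0])
  have 6: "\<exists>\<phi> \<in> ring_iso (P Quot I) A. \<phi> (I +>\<^bsub>P\<^esub> X) = tA"
    unfolding tA A_def I_def X_def P_def by (rule polynomial_presentation[OF d0])
  have 7: "\<exists>\<psi> \<in> ring_iso (reg_image T integer_group int_tern) \<Z>. \<psi> (\<rho>1 tA) = d\<^sup>2"
    unfolding T_def
    by (rule bexI[OF _ reg_image_iso[OF d0]]) (use d0 in \<open>simp add: \<rho>1_def tA unital_reg_rep_elt scaling_def\<close>)
  have \<kappa>_closed: "\<kappa> \<in> carrier A"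
    by (simp add: \<kappa> A_def d0)
  \<comment> \<open>The principal ideal of multiples of \<kappa> is the ideal generated by
    \<kappa>.\<close>
  have 8: "K = Idl\<^bsub>A\<^esub> {\<kappa>}"
    using A.cgenideal_eq_genideal[OF \<kappa>_closed] unital_defect_eq_cgenideal[OF d0]
    by (simp add: K_def A_def \<kappa>)
  have 9: "\<kappa> \<otimes>\<^bsub>A\<^esub> \<kappa> = \<ominus>\<^bsub>A\<^esub> add_pow A (d\<^sup>2) \<kappa>"
    by (simp add: A_def \<kappa> mult_elt add_pow_elt a_inv_elt d0)
  have 10: "defect_power T integer_group int_tern n = (\<lambda>k. add_pow A (d ^ (2 * (n - 1))) k) ` K" if "n \<ge> 1" for n
  proof -
    \<comment> \<open>With \<open>n = Suc m\<close> the exponent is \<open>2 * m\<close>, so the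
      first power is the defect itself.\<close>
    obtain m where m: "n = Suc m" using \<open>n \<ge> 1\<close> by (cases n) auto
    show ?thesis
      by (simp add: m T_def K_def A_def defect_power_eq unital_defect_eq image_image add_pow_elt d0 ac_simps)
  qed
  have 11: "defect_layer T integer_group int_tern n \<cong> integer_mod_group (nat (d\<^sup>2))" if "n \<ge> 1" for n
    using defect_layer_iso[OF d0, of "n - 1"] that by (simp add: T_def)
  show ?thesis
    using 1 2 3 4 5 6 7 8 9 10 11 by blast
qed

end
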